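(* Let $H$ be a Hopf algebra with bijective antipode $S$ over a field $k$, and let $B\subseteq P$ be a Hopf-Galois $H$-extension such that $B$ is central in $P$. Then $P$ is a right-right stable anti-Yetter-Drinfeld module via the right action $$ph=(S^{-1}(h))^{[2]}\,p\,(S^{-1}(h))^{[1]},\qquad p\in P,\ h\in H,$$ and the given right coaction of $H$ on $P$, where $h^{[1]}\otimes_B h^{[2]}$ denotes the value of the translation map on $h$.
   Context: Algebras are associative and unital over $k$. Sumless Sweedler notation: $\Delta(h)=h^{(1)}\otimes h^{(2)}$, and for a right coaction $\Delta_M(m)=m^{(0)}\otimes m^{(1)}\in M\otimes H$. Let $P$ be a right $H$-comodule algebra, i.e. an algebra with a right $H$-coaction $\Delta_P:P\to P\otimes H$ that is an algebra homomorphism, and let $B:=\{p\in P\mid \Delta_P(p)=p\otimes 1\}$. The extension $B\subseteq P$ is a Hopf-Galois $H$-extension if the canonical map $can:P\otimes_B P\to P\otimes H$, $can(p\otimes p')=p\,\Delta_P(p')=pp'^{(0)}\otimes p'^{(1)}$, is bijective. The translation map is $T:H\to P\otimes_B P$, $T(h):=can^{-1}(1\otimes h)=:h^{[1]}\otimes_B h^{[2]}$ (summation suppressed). A right $H$-module and right $H$-comodule $M$ is a (right-right) anti-Yetter-Drinfeld module if for all $h\in H$, $m\in M$: $\Delta_M(mh)=m^{(0)}h^{(2)}\otimes S^{-1}(h^{(1)})m^{(1)}h^{(3)}$. It is stable if $m^{(0)}m^{(1)}=m$ for all $m\in M$. *)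

theory Defs
  imports Complex_Main "HOL-Library.Poly_Mapping"
begin

text \<open>
  Algebras carry the sort \<open>{ring, monoid_mult}\<close> (a unital ring in which \<open>0 = 1\<close> is allowed)
  together with an explicit scalar multiplication by the field \<open>'k\<close>.
  A tensor product is the free vector space on the set of tuples modulo the subspace spanned by
  the usual relations; its elements are the cosets of that subspace.
\<close>

section \<open>Free vector spaces and their quotients\<close>

definition free_scale :: "'k::field \<Rightarrow> ('x \<Rightarrow>\<^sub>0 'k) \<Rightarrow> ('x \<Rightarrow>\<^sub>0 'k)" where
  "free_scale c x = Poly_Mapping.map ((*) c) x"

definition gen :: "'x \<Rightarrow> ('x \<Rightarrow>\<^sub>0 'k::field)" where
  "gen z = Poly_Mapping.single z 1"

definition free_span :: "('x \<Rightarrow>\<^sub>0 'k::field) set \<Rightarrow> ('x \<Rightarrow>\<^sub>0 'k) set" where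
  "free_span R = module.span free_scale R"

definition qclass :: "('x \<Rightarrow>\<^sub>0 'k::field) set \<Rightarrow> ('x \<Rightarrow>\<^sub>0 'k) \<Rightarrow> ('x \<Rightarrow>\<^sub>0 'k) set" where
  "qclass U x = {y. y - x \<in> U}"

definition qspace :: "('x \<Rightarrow>\<^sub>0 'k::field) set \<Rightarrow> ('x \<Rightarrow>\<^sub>0 'k) set set" where
  "qspace U = {qclass U x |x. True}"

text \<open>Linearity of a map from a vector space with scalar multiplication \<open>s\<close> into the
  quotient by \<open>U\<close>, phrased through the elements of the cosets.\<close>

definition qlinear ::
  "('k::field \<Rightarrow> 'm::ab_group_add \<Rightarrow> 'm) \<Rightarrow> ('x \<Rightarrow>\<^sub>0 'k) set \<Rightarrow> ('m \<Rightarrow> ('x \<Rightarrow>\<^sub>0 'k) set) \<Rightarrow> bool" where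
  "qlinear s U F \<longleftrightarrow>
     (\<forall>m. F m \<in> qspace U) \<and>
     (\<forall>m m'. \<forall>x\<in>F m. \<forall>y\<in>F m'. x + y \<in> F (m + m')) \<and>
     (\<forall>c m. \<forall>x\<in>F m. free_scale c x \<in> F (s c m))"

text \<open>The linear extension of \<open>f\<close> from the basis to the free vector space, with values
  in a vector space with scalar multiplication \<open>s\<close>.\<close>

definition lincomb :: "('k::field \<Rightarrow> 'n::ab_group_add \<Rightarrow> 'n) \<Rightarrow> ('x \<Rightarrow> 'n) \<Rightarrow> ('x \<Rightarrow>\<^sub>0 'k) \<Rightarrow> 'n" where
  "lincomb s f x = (\<Sum>z\<in>Poly_Mapping.keys x. s (Poly_Mapping.lookup x z) (f z))"

text \<open>The same when the values \<open>f z\<close> are cosets of \<open>U\<close>: the coset of all linear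
  combinations of representatives.\<close>

definition qlincomb ::
  "('y \<Rightarrow>\<^sub>0 'k::field) set \<Rightarrow> ('x \<Rightarrow> ('y \<Rightarrow>\<^sub>0 'k) set) \<Rightarrow> ('x \<Rightarrow>\<^sub>0 'k) \<Rightarrow> ('y \<Rightarrow>\<^sub>0 'k) set" where
  "qlincomb U f x =
     {y. \<exists>g. (\<forall>z\<in>Poly_Mapping.keys x. g z \<in> f z) \<and> y - lincomb free_scale g x \<in> U}"

text \<open>The common value of \<open>F\<close> on all representatives of the coset \<open>t\<close>
  (unspecified if \<open>F\<close> is not constant on \<open>t\<close>).\<close>

definition descend :: "('a \<Rightarrow> 'b) \<Rightarrow> 'a set \<Rightarrow> 'b" where
  "descend F t = the_elem (F ` t)"

section \<open>Tensor products\<close>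

definition tensor_sub ::
  "('k::field \<Rightarrow> 'a::ab_group_add \<Rightarrow> 'a) \<Rightarrow> ('k \<Rightarrow> 'b::ab_group_add \<Rightarrow> 'b) \<Rightarrow> ('a \<times> 'b \<Rightarrow>\<^sub>0 'k) set" where
  "tensor_sub sA sB = free_span
     ({gen (a + a', b) - gen (a, b) - gen (a', b) |a a' b. True} \<union>
      {gen (a, b + b') - gen (a, b) - gen (a, b') |a b b'. True} \<union>
      {gen (sA c a, b) - free_scale c (gen (a, b)) |c a b. True} \<union>
      {gen (a, sB c b) - free_scale c (gen (a, b)) |c a b. True})"

definition tensor3_sub ::
  "('k::field \<Rightarrow> 'a::ab_group_add \<Rightarrow> 'a) \<Rightarrow> ('k \<Rightarrow> 'b::ab_group_add \<Rightarrow> 'b) \<Rightarrow>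
   ('k \<Rightarrow> 'c::ab_group_add \<Rightarrow> 'c) \<Rightarrow> ('a \<times> 'b \<times> 'c \<Rightarrow>\<^sub>0 'k) set" where
  "tensor3_sub sA sB sC = free_span
     ({gen (a + a', b, c) - gen (a, b, c) - gen (a', b, c) |a a' b c. True} \<union>
      {gen (a, b + b', c) - gen (a, b, c) - gen (a, b', c) |a b b' c. True} \<union>
      {gen (a, b, c + c') - gen (a, b, c) - gen (a, b, c') |a b c c'. True} \<union>
      {gen (sA r a, b, c) - free_scale r (gen (a, b, c)) |r a b c. True} \<union>
      {gen (a, sB r b, c) - free_scale r (gen (a, b, c)) |r a b c. True} \<union>
      {gen (a, b, sC r c) - free_scale r (gen (a, b, c)) |r a b c. True})"

text \<open>The tensor product of \<open>P\<close> with itself over a subset \<open>B\<close> of \<open>P\<close>.\<close>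

definition balanced_sub ::
  "('k::field \<Rightarrow> 'p::{ring,monoid_mult} \<Rightarrow> 'p) \<Rightarrow> 'p set \<Rightarrow> ('p \<times> 'p \<Rightarrow>\<^sub>0 'k) set" where
  "balanced_sub s B = free_span
     (tensor_sub s s \<union> {gen (p * b, p') - gen (p, b * p') |p b p'. b \<in> B})"

definition pure ::
  "('k::field \<Rightarrow> 'a::ab_group_add \<Rightarrow> 'a) \<Rightarrow> ('k \<Rightarrow> 'b::ab_group_add \<Rightarrow> 'b) \<Rightarrow>
   'a \<Rightarrow> 'b \<Rightarrow> ('a \<times> 'b \<Rightarrow>\<^sub>0 'k) set" where
  "pure sA sB a b = qclass (tensor_sub sA sB) (gen (a, b))"

definition pure3 ::
  "('k::field \<Rightarrow> 'a::ab_group_add \<Rightarrow> 'a) \<Rightarrow> ('k \<Rightarrow> 'b::ab_group_add \<Rightarrow> 'b) \<Rightarrow>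
   ('k \<Rightarrow> 'c::ab_group_add \<Rightarrow> 'c) \<Rightarrow> 'a \<Rightarrow> 'b \<Rightarrow> 'c \<Rightarrow> ('a \<times> 'b \<times> 'c \<Rightarrow>\<^sub>0 'k) set" where
  "pure3 sA sB sC a b c = qclass (tensor3_sub sA sB sC) (gen (a, b, c))"

text \<open>For \<open>t = \<Sum> a \<otimes> b\<close> these are \<open>\<Sum> f a b\<close>, with \<open>f\<close> taking values in a
  vector space and in the quotient by \<open>U\<close>, respectively.  They render Sweedler notation:
  \<open>tsum s (\<Delta> h) (\<lambda>h1 h2. e)\<close> is \<open>e\<close> with \<open>h1\<close>, \<open>h2\<close> the summation-suppressed
  components of \<open>\<Delta> h\<close>.\<close>

definition tsum ::
  "('k::field \<Rightarrow> 'n::ab_group_add \<Rightarrow> 'n) \<Rightarrow> ('a \<times> 'b \<Rightarrow>\<^sub>0 'k) set \<Rightarrow> ('a \<Rightarrow> 'b \<Rightarrow> 'n) \<Rightarrow> 'n" where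
  "tsum s t f = descend (lincomb s (\<lambda>(a, b). f a b)) t"

definition tqsum ::
  "('y \<Rightarrow>\<^sub>0 'k::field) set \<Rightarrow> ('a \<times> 'b \<Rightarrow>\<^sub>0 'k) set \<Rightarrow> ('a \<Rightarrow> 'b \<Rightarrow> ('y \<Rightarrow>\<^sub>0 'k) set) \<Rightarrow>
   ('y \<Rightarrow>\<^sub>0 'k) set" where
  "tqsum U t f = descend (qlincomb U (\<lambda>(a, b). f a b)) t"

text \<open>\<open>(a \<otimes> b)(a' \<otimes> b') = aa' \<otimes> bb'\<close>\<close>

definition tensor_mult ::
  "('k::field \<Rightarrow> 'a::{ring,monoid_mult} \<Rightarrow> 'a) \<Rightarrow> ('k \<Rightarrow> 'b::{ring,monoid_mult} \<Rightarrow> 'b) \<Rightarrow>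
   ('a \<times> 'b \<Rightarrow>\<^sub>0 'k) set \<Rightarrow> ('a \<times> 'b \<Rightarrow>\<^sub>0 'k) set \<Rightarrow> ('a \<times> 'b \<Rightarrow>\<^sub>0 'k) set" where
  "tensor_mult sA sB t u =
     tqsum (tensor_sub sA sB) t (\<lambda>a b. tqsum (tensor_sub sA sB) u (\<lambda>a' b'.
       pure sA sB (a * a') (b * b')))"

section \<open>Hopf algebras\<close>

locale k_algebra = vector_space s
  for s :: "'k::field \<Rightarrow> 'a::{ring,monoid_mult} \<Rightarrow> 'a" +
  assumes scale_mult_left: "s c x * y = s c (x * y)"
    and scale_mult_right: "x * s c y = s c (x * y)"

locale right_comodule = H: vector_space sH + M: vector_space sM
  for sH :: "'k::field \<Rightarrow> 'h::ab_group_add \<Rightarrow> 'h"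
    and \<Delta>H :: "'h \<Rightarrow> ('h \<times> 'h \<Rightarrow>\<^sub>0 'k) set"
    and \<epsilon> :: "'h \<Rightarrow> 'k"
    and sM :: "'k \<Rightarrow> 'm::ab_group_add \<Rightarrow> 'm"
    and \<Delta>M :: "'m \<Rightarrow> ('m \<times> 'h \<Rightarrow>\<^sub>0 'k) set" +
  assumes coaction_linear: "qlinear sM (tensor_sub sM sH) \<Delta>M"
    and coaction_coassoc:
      "tqsum (tensor3_sub sM sH sH) (\<Delta>M m) (\<lambda>m' h2.
         tqsum (tensor3_sub sM sH sH) (\<Delta>M m') (\<lambda>m0 h1. pure3 sM sH sH m0 h1 h2)) =
       tqsum (tensor3_sub sM sH sH) (\<Delta>M m) (\<lambda>m0 h.
         tqsum (tensor3_sub sM sH sH) (\<Delta>H h) (\<lambda>h1 h2. pure3 sM sH sH m0 h1 h2))"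
    and coaction_counit: "tsum sM (\<Delta>M m) (\<lambda>m0 m1. sM (\<epsilon> m1) m0) = m"

text \<open>The axioms of a coalgebra are those of the right regular comodule together with
  linearity of \<open>\<epsilon>\<close> and the left counit axiom.\<close>

locale coalgebra = right_comodule s \<Delta> \<epsilon> s \<Delta>
  for s :: "'k::field \<Rightarrow> 'h::ab_group_add \<Rightarrow> 'h"
    and \<Delta> :: "'h \<Rightarrow> ('h \<times> 'h \<Rightarrow>\<^sub>0 'k) set"
    and \<epsilon> :: "'h \<Rightarrow> 'k" +
  assumes counit_linear: "Vector_Spaces.linear s (*) \<epsilon>"
    and counit_left: "tsum s (\<Delta> h) (\<lambda>h1 h2. s (\<epsilon> h1) h2) = h"

locale hopf_algebra = k_algebra s + coalgebra s \<Delta> \<epsilon>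
  for s :: "'k::field \<Rightarrow> 'h::{ring,monoid_mult} \<Rightarrow> 'h"
    and \<Delta> :: "'h \<Rightarrow> ('h \<times> 'h \<Rightarrow>\<^sub>0 'k) set"
    and \<epsilon> :: "'h \<Rightarrow> 'k"
    and S :: "'h \<Rightarrow> 'h" +
  assumes comult_mult: "\<Delta> (g * h) = tensor_mult s s (\<Delta> g) (\<Delta> h)"
    and comult_one: "\<Delta> 1 = pure s s 1 1"
    and counit_mult: "\<epsilon> (g * h) = \<epsilon> g * \<epsilon> h"
    and counit_one: "\<epsilon> 1 = 1"
    and antipode_linear: "Vector_Spaces.linear s s S"
    and antipode_left: "tsum s (\<Delta> h) (\<lambda>h1 h2. S h1 * h2) = s (\<epsilon> h) 1"
    and antipode_right: "tsum s (\<Delta> h) (\<lambda>h1 h2. h1 * S h2) = s (\<epsilon> h) 1"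

section \<open>Hopf--Galois extensions\<close>

locale right_comodule_algebra = H: hopf_algebra sH \<Delta>H \<epsilon> S + P: k_algebra sP
    + right_comodule sH \<Delta>H \<epsilon> sP \<Delta>P
  for sH :: "'k::field \<Rightarrow> 'h::{ring,monoid_mult} \<Rightarrow> 'h"
    and \<Delta>H \<epsilon> S
    and sP :: "'k \<Rightarrow> 'p::{ring,monoid_mult} \<Rightarrow> 'p"
    and \<Delta>P :: "'p \<Rightarrow> ('p \<times> 'h \<Rightarrow>\<^sub>0 'k) set" +
  assumes coaction_mult: "\<Delta>P (p * q) = tensor_mult sP sH (\<Delta>P p) (\<Delta>P q)"
    and coaction_one: "\<Delta>P 1 = pure sP sH 1 1"

definition coinvariants ::
  "('k::field \<Rightarrow> 'h::{ring,monoid_mult} \<Rightarrow> 'h) \<Rightarrow> ('k \<Rightarrow> 'p::{ring,monoid_mult} \<Rightarrow> 'p) \<Rightarrow>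
   ('p \<Rightarrow> ('p \<times> 'h \<Rightarrow>\<^sub>0 'k) set) \<Rightarrow> 'p set" where
  "coinvariants sH sP \<Delta>P = {p. \<Delta>P p = pure sP sH p 1}"

definition tensor_over_coinvariants ::
  "('k::field \<Rightarrow> 'h::{ring,monoid_mult} \<Rightarrow> 'h) \<Rightarrow> ('k \<Rightarrow> 'p::{ring,monoid_mult} \<Rightarrow> 'p) \<Rightarrow>
   ('p \<Rightarrow> ('p \<times> 'h \<Rightarrow>\<^sub>0 'k) set) \<Rightarrow> ('p \<times> 'p \<Rightarrow>\<^sub>0 'k) set set" where
  "tensor_over_coinvariants sH sP \<Delta>P = qspace (balanced_sub sP (coinvariants sH sP \<Delta>P))"

definition can_map ::
  "('k::field \<Rightarrow> 'h::{ring,monoid_mult} \<Rightarrow> 'h) \<Rightarrow> ('k \<Rightarrow> 'p::{ring,monoid_mult} \<Rightarrow> 'p) \<Rightarrow>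
   ('p \<Rightarrow> ('p \<times> 'h \<Rightarrow>\<^sub>0 'k) set) \<Rightarrow> ('p \<times> 'p \<Rightarrow>\<^sub>0 'k) set \<Rightarrow> ('p \<times> 'h \<Rightarrow>\<^sub>0 'k) set" where
  "can_map sH sP \<Delta>P t =
     tqsum (tensor_sub sP sH) t (\<lambda>p p'.
       tqsum (tensor_sub sP sH) (\<Delta>P p') (\<lambda>p0 p1. pure sP sH (p * p0) p1))"

locale hopf_galois_extension = right_comodule_algebra sH \<Delta>H \<epsilon> S sP \<Delta>P
  for sH :: "'k::field \<Rightarrow> 'h::{ring,monoid_mult} \<Rightarrow> 'h"
    and \<Delta>H \<epsilon> S
    and sP :: "'k \<Rightarrow> 'p::{ring,monoid_mult} \<Rightarrow> 'p"
    and \<Delta>P +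
  assumes can_bij: "bij_betw (can_map sH sP \<Delta>P)
    (tensor_over_coinvariants sH sP \<Delta>P) (qspace (tensor_sub sP sH))"

definition translation_map ::
  "('k::field \<Rightarrow> 'h::{ring,monoid_mult} \<Rightarrow> 'h) \<Rightarrow> ('k \<Rightarrow> 'p::{ring,monoid_mult} \<Rightarrow> 'p) \<Rightarrow>
   ('p \<Rightarrow> ('p \<times> 'h \<Rightarrow>\<^sub>0 'k) set) \<Rightarrow> 'h \<Rightarrow> ('p \<times> 'p \<Rightarrow>\<^sub>0 'k) set" where
  "translation_map sH sP \<Delta>P h =
     inv_into (tensor_over_coinvariants sH sP \<Delta>P) (can_map sH sP \<Delta>P) (pure sP sH 1 h)"

text \<open>\<open>p h = (S\<inverse> h)\<^sup>[\<^sup>2\<^sup>] p (S\<inverse> h)\<^sup>[\<^sup>1\<^sup>]\<close>; the sum does not depend on the representative of the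
  translation map when the coinvariants are central.\<close>

definition galois_action ::
  "('k::field \<Rightarrow> 'h::{ring,monoid_mult} \<Rightarrow> 'h) \<Rightarrow> ('h \<Rightarrow> 'h) \<Rightarrow>
   ('k \<Rightarrow> 'p::{ring,monoid_mult} \<Rightarrow> 'p) \<Rightarrow> ('p \<Rightarrow> ('p \<times> 'h \<Rightarrow>\<^sub>0 'k) set) \<Rightarrow> 'p \<Rightarrow> 'h \<Rightarrow> 'p" where
  "galois_action sH S sP \<Delta>P p h =
     tsum sP (translation_map sH sP \<Delta>P (inv S h)) (\<lambda>x y. y * p * x)"

section \<open>Stable anti-Yetter--Drinfeld modules\<close>

locale right_module = H: k_algebra sH + M: vector_space sM
  for sH :: "'k::field \<Rightarrow> 'h::{ring,monoid_mult} \<Rightarrow> 'h"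
    and sM :: "'k \<Rightarrow> 'm::ab_group_add \<Rightarrow> 'm"
    and act :: "'m \<Rightarrow> 'h \<Rightarrow> 'm" +
  assumes act_linear_left: "Vector_Spaces.linear sM sM (\<lambda>m. act m h)"
    and act_linear_right: "Vector_Spaces.linear sH sM (\<lambda>h. act m h)"
    and act_one: "act m 1 = m"
    and act_mult: "act m (h * g) = act (act m h) g"

locale anti_yetter_drinfeld_module = H: hopf_algebra sH \<Delta>H \<epsilon> S
    + right_module sH sM act + right_comodule sH \<Delta>H \<epsilon> sM \<Delta>M
  for sH :: "'k::field \<Rightarrow> 'h::{ring,monoid_mult} \<Rightarrow> 'h"
    and \<Delta>H \<epsilon> S
    and sM :: "'k \<Rightarrow> 'm::ab_group_add \<Rightarrow> 'm"
    and act \<Delta>M +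
  assumes antipode_bij: "bij S"
    and anti_yetter_drinfeld:
      "\<Delta>M (act m h) =
         tqsum (tensor_sub sM sH) (\<Delta>M m) (\<lambda>m0 m1.
           tqsum (tensor_sub sM sH) (\<Delta>H h) (\<lambda>h1 h'.
             tqsum (tensor_sub sM sH) (\<Delta>H h') (\<lambda>h2 h3.
               pure sM sH (act m0 h2) (inv S h1 * m1 * h3))))"

locale stable_anti_yetter_drinfeld_module =
  anti_yetter_drinfeld_module sH \<Delta>H \<epsilon> S sM act \<Delta>M
  for sH :: "'k::field \<Rightarrow> 'h::{ring,monoid_mult} \<Rightarrow> 'h"
    and \<Delta>H \<epsilon> S
    and sM :: "'k \<Rightarrow> 'm::ab_group_add \<Rightarrow> 'm"
    and act \<Delta>M +
  assumes stable: "tsum sM (\<Delta>M m) (\<lambda>m0 m1. act m0 m1) = m"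

end

theory Submission
  imports Defs
begin

text \<open>
  Elements of quotients of free vector spaces are compared by evaluating them at functionals, so that
  \<open>\<Sum> f a b\<close> over a tensor \<open>\<Sum> a \<otimes> b\<close> becomes \<open>sw t f\<close> with \<open>f\<close> a scalar-valued bilinear
  form; an identity in a tensor product is then an identity between such sums for all multilinear forms.

  Injectivity of the canonical map gives \<open>p \<otimes> p' = p p'\<^sub>0 p'\<^sub>1\<^sup>[\<^sup>1\<^sup>] \<otimes> p'\<^sub>1\<^sup>[\<^sup>2\<^sup>]\<close> in \<open>P \<otimes>\<^sub>B P\<close>, and
  with \<open>h\<^sup>[\<^sup>1\<^sup>] h\<^sup>[\<^sup>2\<^sup>]\<^sub>0 \<otimes> h\<^sup>[\<^sup>2\<^sup>]\<^sub>1 = 1 \<otimes> h\<close> this yields how the translation map interacts with products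
  and with the coaction on either leg.  Since \<open>B\<close> is central, \<open>x \<otimes> y \<mapsto> y p x\<close> is well defined on
  \<open>P \<otimes>\<^sub>B P\<close>; multiplicativity of the translation map gives the module law, the coaction
  formulas give the anti-Yetter--Drinfeld condition, and applying \<open>x \<otimes> y \<mapsto> y x\<close> to
  \<open>(S\<inverse> p\<^sub>1)\<^sup>[\<^sup>1\<^sup>] \<otimes> (S\<inverse> p\<^sub>1)\<^sup>[\<^sup>2\<^sup>] p\<^sub>0 = p \<otimes> 1\<close> gives stability.
\<close>

section \<open>Linear functionals on quotients of free vector spaces\<close>

lemma vector_space_field: "vector_space ((*) :: 'k::field \<Rightarrow> 'k \<Rightarrow> 'k)"
  by unfold_locales (simp_all add: algebra_simps)

lemma lookup_free_scale [simp]: "Poly_Mapping.lookup (free_scale c x) z = c * Poly_Mapping.lookup x z"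
  by (simp add: free_scale_def Poly_Mapping.map.rep_eq when_def)

lemma vector_space_free: "vector_space (free_scale :: 'k::field \<Rightarrow> ('x \<Rightarrow>\<^sub>0 'k) \<Rightarrow> _)"
  by unfold_locales (simp_all add: poly_mapping_eqI lookup_add algebra_simps)

interpretation free: vector_space "free_scale :: 'k::field \<Rightarrow> ('x \<Rightarrow>\<^sub>0 'k) \<Rightarrow> _"
  by (rule vector_space_free)

lemma linearD:
  assumes "Vector_Spaces.linear s s' f"
  shows linear_addD: "f (x + y) = f x + f y" and linear_scaleD: "f (s c x) = s' c (f x)"
  using assms by (simp_all add: Vector_Spaces.linear_iff)

lemma linear_zeroD:
  assumes "Vector_Spaces.linear s s' f"
  shows "f 0 = 0"
  using linear_addD[OF assms, of 0 0] by simp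

text \<open>A basis of \<open>U\<close> stays independent after adding \<open>x\<close>, so some
  functional is 1 at \<open>x\<close> and 0 on the basis, hence on all of \<open>U\<close>.\<close>

lemma (in vector_space) linear_functional_separates:
  assumes U: "subspace U" and x: "x \<notin> U"
  obtains \<psi> where "Vector_Spaces.linear scale (*) \<psi>" "\<And>u. u \<in> U \<Longrightarrow> \<psi> u = 0" "\<psi> x = 1"
proof -
  obtain B where B: "B \<subseteq> U" "independent B" "U \<subseteq> span B"
    using basis_exists[of U] by metis
  have "span B = U"
    using span_minimal[OF B(1) U] B(3) by (rule subset_antisym)
  then have xs: "x \<notin> span B" using x by simp
  have ind: "independent (insert x B)"
    using xs B(2) by (rule independent_insertI)
  have xB: "x \<notin> B" using x B(1) by (rule contra_subsetD[rotated])
  interpret vsp: vector_space_pair scale "(*)"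
    by (rule vector_space_pair.intro) (rule vector_space_axioms, rule vector_space_field)
  obtain g where g: "Vector_Spaces.linear scale (*) g" "\<forall>v\<in>insert x B. g v = (if v = x then 1 else 0)"
    using vsp.linear_independent_extend[OF ind] by (rule exE, elim conjE) (rule that)
  have gB: "B \<subseteq> {v. g v = 0}"
  proof
    fix v assume "v \<in> B"
    with xB have "v \<noteq> x" "v \<in> insert x B" by auto
    then show "v \<in> {v. g v = 0}" using g(2) by simp
  qed
  have "subspace {v. g v = 0}"
    by (simp add: subspace_def linear_addD[OF g(1)] linear_scaleD[OF g(1)] linear_zeroD[OF g(1)])
  then have "span B \<subseteq> {v. g v = 0}"
    by (rule span_minimal[OF gB])
  with B(3) have "g u = 0" if "u \<in> U" for u
    using that by (simp add: subset_iff)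
  moreover have "g x = 1" using g(2) by simp
  ultimately show ?thesis by (rule that[OF g(1)])
qed

text \<open>Separation from the zero subspace. This is how identities between vectors are reduced to
  scalar identities throughout.\<close>

lemma (in vector_space) eqI_functionals:
  assumes "\<And>\<psi>. Vector_Spaces.linear scale (*) \<psi> \<Longrightarrow> \<psi> x = \<psi> y"
  shows "x = y"
proof (rule ccontr)
  assume "x \<noteq> y"
  then have "x - y \<notin> {0}" by simp
  then obtain \<psi> where \<psi>: "Vector_Spaces.linear scale (*) \<psi>" "\<psi> (x - y) = 1"
    using linear_functional_separates[OF subspace_single_0] by metis
  have "\<psi> x = \<psi> (x - y) + \<psi> y"
    using linear_addD[OF \<psi>(1), of "x - y" y] by simp
  then show False using assms[OF \<psi>(1)] \<psi>(2) by simp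
qed

section \<open>Linear extension from the generators\<close>

context vector_space
begin

lemma lincomb_superset:
  assumes "finite A" "Poly_Mapping.keys x \<subseteq> A"
  shows "lincomb scale f x = (\<Sum>z\<in>A. scale (Poly_Mapping.lookup x z) (f z))"
  unfolding lincomb_def using assms
  by (intro sum.mono_neutral_left) (auto simp: in_keys_iff)

lemma linear_lincomb: "Vector_Spaces.linear free_scale scale (lincomb scale f)"
  unfolding Vector_Spaces.linear_iff
proof (intro conjI allI)
  show "lincomb scale f (x + y) = lincomb scale f x + lincomb scale f y" for x y
  proof -
    let ?A = "Poly_Mapping.keys x \<union> Poly_Mapping.keys y"
    have "Poly_Mapping.keys (x + y) \<subseteq> ?A" by (rule keys_add)
    then show ?thesis
      by (simp add: lincomb_superset[of ?A] lookup_add scale_left_distrib sum.distrib)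
  qed
  show "lincomb scale f (free_scale c x) = scale c (lincomb scale f x)" for c x
  proof -
    have "Poly_Mapping.keys (free_scale c x) \<subseteq> Poly_Mapping.keys x"
      by (auto simp: in_keys_iff)
    then show ?thesis
      by (simp add: lincomb_superset[of "Poly_Mapping.keys x"] scale_sum_right)
  qed
qed unfold_locales

lemma lincomb_gen [simp]: "lincomb scale f (gen z) = f z"
  by (simp add: lincomb_def gen_def)

lemma lincomb_add [simp]: "lincomb scale f (x + y) = lincomb scale f x + lincomb scale f y"
  by (rule linear_addD[OF linear_lincomb])

lemma lincomb_free_scale [simp]: "lincomb scale f (free_scale c x) = scale c (lincomb scale f x)"
  by (rule linear_scaleD[OF linear_lincomb])

lemma lincomb_diff [simp]: "lincomb scale f (x - y) = lincomb scale f x - lincomb scale f y"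
  using lincomb_add[of f "x - y" y] by (simp add: algebra_simps)

end

text \<open>Interpreting \<open>vector_space\<close> for the field itself would make \<open>scale_scale\<close> a rewrite rule that
  loops with \<open>mult.assoc\<close>, so the required instances are listed.\<close>

lemmas linear_lincomb_field = vector_space.linear_lincomb[OF vector_space_field]

lemmas lincomb_field_simps [simp] =
  vector_space.lincomb_gen[OF vector_space_field]
  vector_space.lincomb_add[OF vector_space_field]
  vector_space.lincomb_free_scale[OF vector_space_field]
  vector_space.lincomb_diff[OF vector_space_field]

lemma linear_lincomb_comp:
  assumes "Vector_Spaces.linear s s' L"
  shows "L (lincomb s f x) = lincomb s' (\<lambda>z. L (f z)) x"
proof -
  interpret Vector_Spaces.linear s s' L by fact
  show ?thesis by (simp add: lincomb_def sum scale)
qed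

lemma lincomb_free_gen: "lincomb free_scale gen x = x"
proof (rule poly_mapping_eqI)
  fix k
  have "Poly_Mapping.lookup (lincomb free_scale gen x) k =
      (\<Sum>z\<in>Poly_Mapping.keys x. if z = k then Poly_Mapping.lookup x z else 0)"
    by (simp add: lincomb_def lookup_sum gen_def lookup_single when_def if_distrib cong: if_cong)
  also have "\<dots> = Poly_Mapping.lookup x k" by (simp add: in_keys_iff)
  finally show "Poly_Mapping.lookup (lincomb free_scale gen x) k = Poly_Mapping.lookup x k" .
qed

lemma linear_eq_lincomb:
  assumes "Vector_Spaces.linear free_scale s L"
  shows "L x = lincomb s (\<lambda>z. L (gen z)) x"
  using linear_lincomb_comp[OF assms, of gen x] by (simp add: lincomb_free_gen)

text \<open>A function on the generators encodes a linear form on the free space; those that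
  annihilate a subspace \<open>U\<close> are the forms that descend to the quotient by
  \<open>U\<close>.\<close>

definition annihilates :: "('x \<Rightarrow> 'k::field) \<Rightarrow> ('x \<Rightarrow>\<^sub>0 'k) set \<Rightarrow> bool" where
  "annihilates f U \<longleftrightarrow> (\<forall>x\<in>U. lincomb (*) f x = 0)"

text \<open>A form need only be tested on the defining relations; for the tensor products below this
  turns annihilation into multilinearity.\<close>

lemma annihilates_span: "annihilates f (free_span R) \<longleftrightarrow> annihilates f R"
proof
  have "R \<subseteq> free_span R" unfolding free_span_def by (rule free.span_superset)
  then show "annihilates f (free_span R) \<Longrightarrow> annihilates f R"
    unfolding annihilates_def by blast
next
  assume *: "annihilates f R"
  have "lincomb (*) f x = 0" if "x \<in> free.span R" for x
    using that
  proof (induction rule: free.span_induct_alt)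
    case base
    then show ?case by (simp add: lincomb_def)
  next
    case (step c x y)
    then show ?case using * by (simp add: annihilates_def)
  qed
  then show "annihilates f (free_span R)"
    by (simp add: annihilates_def free_span_def)
qed

text \<open>A functional separating \<open>x - y\<close> from \<open>U\<close> is determined by its
  values on the generators, and these values give an annihilating \<open>f\<close>.\<close>

lemma annihilates_separates:
  assumes "free.subspace U" "\<And>f. annihilates f U \<Longrightarrow> lincomb (*) f x = lincomb (*) f y"
  shows "x - y \<in> U"
proof (rule ccontr)
  assume "x - y \<notin> U"
  then obtain \<psi> where \<psi>: "Vector_Spaces.linear free_scale (*) \<psi>" "\<And>u. u \<in> U \<Longrightarrow> \<psi> u = 0" "\<psi> (x - y) = 1"
    using free.linear_functional_separates[OF assms(1)] by metis
  let ?f = "\<lambda>z. \<psi> (gen z)"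
  have "annihilates ?f U"
    using \<psi>(2) by (simp add: annihilates_def linear_eq_lincomb[OF \<psi>(1), symmetric])
  from assms(2)[OF this] have "lincomb (*) ?f (x - y) = 0" by simp
  with \<psi>(3) show False by (simp add: linear_eq_lincomb[OF \<psi>(1), symmetric])
qed

text \<open>The value does not depend on the chosen representative when \<open>f\<close> annihilates
  the subspace in question. Since \<open>ev\<close> is always a finite sum, rules such as
  \<open>sw_commute\<close> carry no side conditions.\<close>

definition ev :: "('x \<Rightarrow> 'k::field) \<Rightarrow> ('x \<Rightarrow>\<^sub>0 'k) set \<Rightarrow> 'k" where
  "ev f t = lincomb (*) f (SOME x. x \<in> t)"

lemma qclass_in_qspace [simp, intro]: "qclass U x \<in> qspace U"
  by (auto simp: qspace_def)

lemma qclass_self: "free.subspace U \<Longrightarrow> x \<in> qclass U x"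
  by (simp add: qclass_def free.subspace_0)

lemma qclass_eq_iff:
  assumes "free.subspace U"
  shows "qclass U x = qclass U y \<longleftrightarrow> x - y \<in> U"
proof
  assume "qclass U x = qclass U y"
  then show "x - y \<in> U" using qclass_self[OF assms, of x] by (simp add: qclass_def)
next
  assume xy: "x - y \<in> U"
  have "z - x \<in> U \<longleftrightarrow> z - y \<in> U" for z
    using free.subspace_add[OF assms, of "z - x" "x - y"]
      free.subspace_diff[OF assms, of "z - y" "x - y"] xy by auto
  then show "qclass U x = qclass U y" by (simp add: qclass_def)
qed

lemma qspace_eq_qclass:
  assumes "free.subspace U" "t \<in> qspace U" "x \<in> t"
  shows "t = qclass U x"
proof -
  obtain y where y: "t = qclass U y" using assms(2) by (auto simp: qspace_def)
  then have "x - y \<in> U" using assms(3) by (simp add: qclass_def)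
  then have "qclass U x = qclass U y" by (rule qclass_eq_iff[OF assms(1), THEN iffD2])
  with y show ?thesis by simp
qed

lemma qspace_nonempty:
  assumes "free.subspace U" "t \<in> qspace U"
  obtains x where "x \<in> t"
  using assms qclass_self by (force simp: qspace_def)

lemma qspace_some_in:
  assumes "free.subspace U" "t \<in> qspace U"
  shows "(SOME x. x \<in> t) \<in> t"
  using qspace_nonempty[OF assms] someI[of "\<lambda>x. x \<in> t"] by metis

lemma annihilates_eq:
  assumes "free.subspace U" "t \<in> qspace U" "x \<in> t" "y \<in> t" "annihilates f U"
  shows "lincomb (*) f x = lincomb (*) f y"
proof -
  have "x - y \<in> U"
    using qspace_eq_qclass[OF assms(1,2,4)] assms(3) by (simp add: qclass_def)
  then have "lincomb (*) f (x - y) = 0" using assms(5) unfolding annihilates_def by blast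
  then show ?thesis by (simp only: lincomb_field_simps right_minus_eq)
qed

lemma ev_eq:
  assumes "free.subspace U" "t \<in> qspace U" "x \<in> t" "annihilates f U"
  shows "ev f t = lincomb (*) f x"
  unfolding ev_def by (rule annihilates_eq[OF assms(1,2) qspace_some_in[OF assms(1,2)] assms(3,4)])

lemma ev_qclass:
  assumes "free.subspace U" "annihilates f U"
  shows "ev f (qclass U x) = lincomb (*) f x"
  using ev_eq[OF assms(1) qclass_in_qspace qclass_self[OF assms(1)] assms(2)] .

lemma qspace_eqI:
  assumes "free.subspace U" "t \<in> qspace U" "u \<in> qspace U"
    "\<And>f. annihilates f U \<Longrightarrow> ev f t = ev f u"
  shows "t = u"
proof -
  obtain x where x: "x \<in> t" using qspace_nonempty[OF assms(1,2)] .
  obtain y where y: "y \<in> u" using qspace_nonempty[OF assms(1,3)] .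
  have "x - y \<in> U"
    using assms(4) ev_eq[OF assms(1,2) x] ev_eq[OF assms(1,3) y]
    by (intro annihilates_separates[OF assms(1)]) simp
  then show ?thesis
    using qspace_eq_qclass[OF assms(1,2) x] qspace_eq_qclass[OF assms(1,3) y] qclass_eq_iff[OF assms(1)]
    by metis
qed

lemma subspace_free_span: "free.subspace (free_span R)"
  unfolding free_span_def by simp

lemma ev_qlinear:
  assumes U: "free.subspace U" and F: "qlinear s U F" and f: "annihilates f U" and s: "vector_space s"
  shows "Vector_Spaces.linear s (*) (\<lambda>m. ev f (F m))"
  unfolding Vector_Spaces.linear_iff
proof (intro conjI allI s vector_space_field)
  have F1: "F m \<in> qspace U" for m using F by (simp add: qlinear_def)
  note F2 = ev_eq[OF U F1 _ f]
  fix m m' c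
  obtain x y where x: "x \<in> F m" and y: "y \<in> F m'"
    using qspace_nonempty[OF U F1] by metis
  then have "x + y \<in> F (m + m')" "free_scale c x \<in> F (s c m)"
    using F by (auto simp: qlinear_def)
  with x y show "ev f (F (m + m')) = ev f (F m) + ev f (F m')"
    "ev f (F (s c m)) = c * ev f (F m)"
    using F2 by simp_all
qed

section \<open>Sums over a tensor and their independence of representatives\<close>

lemma descendI:
  assumes "x \<in> t" "\<And>y. y \<in> t \<Longrightarrow> F y = F x"
  shows "descend F t = F x"
proof -
  have "F ` t \<subseteq> {F x}" using assms(2) by blast
  moreover have "F x \<in> F ` t" using assms(1) by (rule imageI)
  ultimately have "F ` t = {F x}" by blast
  then show ?thesis by (simp add: descend_def)
qed

abbreviation sw :: "('a \<times> 'b \<Rightarrow>\<^sub>0 'k::field) set \<Rightarrow> ('a \<Rightarrow> 'b \<Rightarrow> 'k) \<Rightarrow> 'k" where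
  "sw t f \<equiv> ev (case_prod f) t"

text \<open>The hypothesis on \<open>f\<close> makes every functional of the sum independent of the
  representative of \<open>t\<close>. Functionals separate vectors, so the sum itself is constant on
  \<open>t\<close>.\<close>

lemma tsum_functional:
  assumes U: "free.subspace U" and t: "t \<in> qspace U" and s: "vector_space s"
    and f: "\<And>\<psi>. Vector_Spaces.linear s (*) \<psi> \<Longrightarrow> annihilates (\<lambda>(a, b). \<psi> (f a b)) U"
    and \<phi>: "Vector_Spaces.linear s (*) \<phi>"
  shows "\<phi> (tsum s t f) = sw t (\<lambda>a b. \<phi> (f a b))"
proof -
  interpret vector_space s by (rule s)
  let ?x = "SOME x. x \<in> t"
  have x: "?x \<in> t" by (rule qspace_some_in[OF U t])
  have *: "\<psi> (lincomb s (\<lambda>(a, b). f a b) y) = lincomb (*) (\<lambda>(a, b). \<psi> (f a b)) y"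
    if "Vector_Spaces.linear s (*) \<psi>" for \<psi> y
    using linear_lincomb_comp[OF that] by (simp add: case_prod_unfold)
  have "lincomb s (\<lambda>(a, b). f a b) y = lincomb s (\<lambda>(a, b). f a b) ?x" if "y \<in> t" for y
    by (rule eqI_functionals) (simp only: *, rule annihilates_eq[OF U t that x f])
  then have "tsum s t f = lincomb s (\<lambda>(a, b). f a b) ?x"
    unfolding tsum_def by (rule descendI[OF x])
  then show ?thesis by (simp only: *[OF \<phi>] ev_def)
qed

text \<open>Another choice of representatives changes the linear combination by a combination of
  elements of \<open>U\<close>, so the single choice \<open>g\<close> determines the coset.\<close>

lemma qlincomb_eq_qclass:
  assumes U: "free.subspace U" and f: "\<And>z. f z \<in> qspace U" and g: "\<And>z. g z \<in> f z"
  shows "qlincomb U f x = qclass U (lincomb free_scale g x)"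
proof -
  have "lincomb free_scale h x - lincomb free_scale g x \<in> U"
    if h: "\<forall>z\<in>Poly_Mapping.keys x. h z \<in> f z" for h
  proof -
    have "h z - g z \<in> U" if "z \<in> Poly_Mapping.keys x" for z
      using qspace_eq_qclass[OF U f g, of z] h that by (auto simp: qclass_def)
    then have "(\<Sum>z\<in>Poly_Mapping.keys x. free_scale (Poly_Mapping.lookup x z) (h z - g z)) \<in> U"
      by (intro free.subspace_sum[OF U] free.subspace_scale[OF U])
    then show ?thesis
      by (simp add: lincomb_def free.scale_right_diff_distrib sum_subtractf)
  qed
  then have "y - lincomb free_scale h x \<in> U \<Longrightarrow> y - lincomb free_scale g x \<in> U"
    if "\<forall>z\<in>Poly_Mapping.keys x. h z \<in> f z" for h y
    using free.subspace_add[OF U, of "y - lincomb free_scale h x" "lincomb free_scale h x - lincomb free_scale g x"] that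
    by simp
  then show ?thesis using g by (auto simp: qlincomb_def qclass_def)
qed

lemma tqsum_functional:
  assumes U: "free.subspace U" and U': "free.subspace U'" and t: "t \<in> qspace U"
    and f: "\<And>a b. f a b \<in> qspace U'"
    and ann: "\<And>\<psi>. annihilates \<psi> U' \<Longrightarrow> annihilates (\<lambda>(a, b). ev \<psi> (f a b)) U"
  shows "tqsum U' t f \<in> qspace U'"
    and "annihilates \<psi> U' \<Longrightarrow> ev \<psi> (tqsum U' t f) = sw t (\<lambda>a b. ev \<psi> (f a b))"
proof -
  let ?x = "SOME x. x \<in> t"
  \<comment> \<open>\<open>ev\<close> makes the same choice of representatives, so a form applied to
    the combination of the \<open>g z\<close> becomes the combination of the scalars
    \<open>ev \<psi> (f a b)\<close>.\<close>
  define g where "g z = (SOME x. x \<in> case_prod f z)" for z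
  have x: "?x \<in> t" by (rule qspace_some_in[OF U t])
  have f': "case_prod f z \<in> qspace U'" for z using f by (cases z) auto
  have q: "qlincomb U' (\<lambda>(a, b). f a b) y = qclass U' (lincomb free_scale g y)" for y
    unfolding g_def by (intro qlincomb_eq_qclass[OF U'] f' qspace_some_in[OF U'])
  have *: "lincomb (*) \<psi> (lincomb free_scale g y) = lincomb (*) (\<lambda>(a, b). ev \<psi> (f a b)) y" for \<psi> y
    by (simp add: linear_lincomb_comp[OF linear_lincomb_field] g_def ev_def case_prod_unfold)
  have "qlincomb U' (\<lambda>(a, b). f a b) y = qlincomb U' (\<lambda>(a, b). f a b) ?x" if y: "y \<in> t" for y
    unfolding q qclass_eq_iff[OF U']
    by (rule annihilates_separates[OF U']) (simp only: *, rule annihilates_eq[OF U t y x ann])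
  then have **: "tqsum U' t f = qclass U' (lincomb free_scale g ?x)"
    unfolding tqsum_def using descendI[OF x] q by metis
  then show "tqsum U' t f \<in> qspace U'" by simp
  show "ev \<psi> (tqsum U' t f) = sw t (\<lambda>a b. ev \<psi> (f a b))" if "annihilates \<psi> U'"
    unfolding ** ev_qclass[OF U' that] * by (simp add: ev_def)
qed

text \<open>Both sides are finite double sums over the same chosen representatives, so only the
  order of summation changes.\<close>

lemma sw_commute:
  "sw t (\<lambda>a b. sw u (\<lambda>c d. f a b c d)) = sw u (\<lambda>c d. sw t (\<lambda>a b. f a b c d))"
  unfolding ev_def lincomb_def case_prod_unfold sum_distrib_left
  by (subst sum.swap) (intro sum.cong refl mult.left_commute)

lemma sw_mult_left: "sw t (\<lambda>a b. c * f a b) = c * sw t f"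
  unfolding ev_def lincomb_def case_prod_unfold sum_distrib_left
  by (intro sum.cong refl mult.left_commute)

section \<open>Multilinear forms\<close>

definition bilin :: "('k::field \<Rightarrow> 'a::ab_group_add \<Rightarrow> 'a) \<Rightarrow> ('k \<Rightarrow> 'b::ab_group_add \<Rightarrow> 'b) \<Rightarrow>
    ('a \<Rightarrow> 'b \<Rightarrow> 'k) \<Rightarrow> bool" where
  "bilin sA sB f \<longleftrightarrow> (\<forall>b. Vector_Spaces.linear sA (*) (\<lambda>a. f a b)) \<and> (\<forall>a. Vector_Spaces.linear sB (*) (f a))"

lemma bilinI:
  assumes "\<And>b. Vector_Spaces.linear sA (*) (\<lambda>a. f a b)" "\<And>a. Vector_Spaces.linear sB (*) (\<lambda>b. f a b)"
  shows "bilin sA sB f"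
  using assms by (simp add: bilin_def)

lemma subspace_tensor_sub: "free.subspace (tensor_sub sA sB)"
  unfolding tensor_sub_def by (rule subspace_free_span)

lemma subspace_tensor3_sub: "free.subspace (tensor3_sub sA sB sC)"
  unfolding tensor3_sub_def by (rule subspace_free_span)

lemma subspace_balanced_sub: "free.subspace (balanced_sub s B)"
  unfolding balanced_sub_def by (rule subspace_free_span)

lemma ball_setcompr3: "(\<forall>x\<in>{t a b c |a b c. True}. Q x) \<longleftrightarrow> (\<forall>a b c. Q (t a b c))"
  by blast

lemma ball_setcompr4: "(\<forall>x\<in>{t a b c d |a b c d. True}. Q x) \<longleftrightarrow> (\<forall>a b c d. Q (t a b c d))"
  by blast

text \<open>The four families of relations are the two additivity and the two homogeneity laws.
  \<open>Vector_Spaces.linear\<close> also includes that both spaces are vector spaces, which the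
  hypotheses supply.\<close>

lemma annihilates_tensor_sub:
  assumes "vector_space sA" "vector_space sB"
  shows "annihilates f (tensor_sub sA sB) \<longleftrightarrow> bilin sA sB (\<lambda>a b. f (a, b))"
proof -
  have "annihilates f (tensor_sub sA sB) \<longleftrightarrow>
    (\<forall>a a' b. f (a + a', b) = f (a, b) + f (a', b)) \<and> (\<forall>a b b'. f (a, b + b') = f (a, b) + f (a, b')) \<and>
    (\<forall>c a b. f (sA c a, b) = c * f (a, b)) \<and> (\<forall>c a b. f (a, sB c b) = c * f (a, b))"
    unfolding tensor_sub_def annihilates_span
    unfolding annihilates_def ball_Un ball_setcompr3
    by (simp add: diff_eq_eq) (simp add: add.commute)
  also have "\<dots> \<longleftrightarrow> bilin sA sB (\<lambda>a b. f (a, b))"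
    using assms vector_space_field by (auto simp: bilin_def Vector_Spaces.linear_iff)
  finally show ?thesis .
qed

lemma annihilates_tensor3_sub:
  assumes "vector_space sA" "vector_space sB" "vector_space sC"
  shows "annihilates f (tensor3_sub sA sB sC) \<longleftrightarrow>
    (\<forall>b c. Vector_Spaces.linear sA (*) (\<lambda>a. f (a, b, c))) \<and>
    (\<forall>a c. Vector_Spaces.linear sB (*) (\<lambda>b. f (a, b, c))) \<and>
    (\<forall>a b. Vector_Spaces.linear sC (*) (\<lambda>c. f (a, b, c)))"
proof -
  have "annihilates f (tensor3_sub sA sB sC) \<longleftrightarrow>
    (\<forall>a a' b c. f (a + a', b, c) = f (a, b, c) + f (a', b, c)) \<and>
    (\<forall>a b b' c. f (a, b + b', c) = f (a, b, c) + f (a, b', c)) \<and>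
    (\<forall>a b c c'. f (a, b, c + c') = f (a, b, c) + f (a, b, c')) \<and>
    (\<forall>r a b c. f (sA r a, b, c) = r * f (a, b, c)) \<and>
    (\<forall>r a b c. f (a, sB r b, c) = r * f (a, b, c)) \<and>
    (\<forall>r a b c. f (a, b, sC r c) = r * f (a, b, c))"
    unfolding tensor3_sub_def annihilates_span
    unfolding annihilates_def ball_Un ball_setcompr4
    by (simp add: diff_eq_eq) (simp add: add.commute)
  then show ?thesis
    using assms vector_space_field by (auto simp: Vector_Spaces.linear_iff)
qed

lemma ball_setcompr3_cond:
  "(\<forall>x\<in>{t a b c |a b c. C a b c}. Q x) \<longleftrightarrow> (\<forall>a b c. C a b c \<longrightarrow> Q (t a b c))"
  by blast

lemma annihilates_balanced_sub:
  assumes "vector_space s"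
  shows "annihilates f (balanced_sub s B) \<longleftrightarrow>
    bilin s s (\<lambda>a b. f (a, b)) \<and> (\<forall>p b p'. b \<in> B \<longrightarrow> f (p * b, p') = f (p, b * p'))"
proof -
  have "annihilates f (balanced_sub s B) \<longleftrightarrow>
      annihilates f (tensor_sub s s) \<and> (\<forall>p b p'. b \<in> B \<longrightarrow> f (p * b, p') = f (p, b * p'))"
    unfolding balanced_sub_def annihilates_span
    unfolding annihilates_def ball_Un
    by (intro arg_cong2[where f="(\<and>)"] refl)
      (subst ball_setcompr3_cond, simp)
  then show ?thesis by (simp add: annihilates_tensor_sub[OF assms assms])
qed

text \<open>Nested sums are evaluated from the inside out: the first conclusion for an inner sum
  provides the hypothesis on \<open>f\<close> for the next outer one.\<close>

lemma tqsum_tensor: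
  assumes vs: "vector_space sA" "vector_space sB" and U': "free.subspace U'"
    and t: "t \<in> qspace (tensor_sub sA sB)" and f: "\<And>a b. f a b \<in> qspace U'"
    and lin: "\<forall>\<psi>. annihilates \<psi> U' \<longrightarrow> bilin sA sB (\<lambda>a b. ev \<psi> (f a b))"
  shows "tqsum U' t f \<in> qspace U'"
    and "annihilates \<psi> U' \<Longrightarrow> ev \<psi> (tqsum U' t f) = sw t (\<lambda>a b. ev \<psi> (f a b))"
  by (rule tqsum_functional[OF subspace_tensor_sub U' t f],
      simp add: annihilates_tensor_sub[OF vs] lin, assumption?)+

lemma tsum_tensor:
  assumes vs: "vector_space sA" "vector_space sB" "vector_space s"
    and t: "t \<in> qspace (tensor_sub sA sB)"
    and lin: "\<And>\<psi>. Vector_Spaces.linear s (*) \<psi> \<Longrightarrow> bilin sA sB (\<lambda>a b. \<psi> (f a b))"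
    and \<phi>: "Vector_Spaces.linear s (*) \<phi>"
  shows "\<phi> (tsum s t f) = sw t (\<lambda>a b. \<phi> (f a b))"
  by (rule tsum_functional[OF subspace_tensor_sub t vs(3) _ \<phi>])
    (simp add: annihilates_tensor_sub[OF vs(1,2)] lin)

lemma pure_in_qspace: "pure sA sB a b \<in> qspace (tensor_sub sA sB)"
  by (simp add: pure_def)

lemma ev_pure:
  assumes "annihilates f (tensor_sub sA sB)"
  shows "ev f (pure sA sB a b) = f (a, b)"
  unfolding pure_def by (simp add: ev_qclass[OF subspace_tensor_sub assms])

lemma sw_pure:
  assumes "vector_space sA" "vector_space sB" "bilin sA sB f"
  shows "sw (pure sA sB a b) f = f a b"
  by (subst ev_pure) (simp_all add: annihilates_tensor_sub assms)

lemma tensor_eqI: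
  assumes "vector_space sA" "vector_space sB"
    and "t \<in> qspace (tensor_sub sA sB)" "u \<in> qspace (tensor_sub sA sB)"
    and "\<And>f. bilin sA sB f \<Longrightarrow> sw t f = sw u f"
  shows "t = u"
proof (rule qspace_eqI[OF subspace_tensor_sub assms(3,4)])
  fix f assume "annihilates f (tensor_sub sA sB)"
  then have "bilin sA sB (\<lambda>a b. f (a, b))" by (simp add: annihilates_tensor_sub[OF assms(1,2)])
  from assms(5)[OF this] show "ev f t = ev f u" by simp
qed

text \<open>In each rule the variable \<open>x\<close> occurs in exactly one argument, so that at most one rule applies to a
  multilinear expression and \<open>intro multilinear\<close> needs no backtracking.\<close>

named_theorems multilinear

lemma linear_functional_comp:
  assumes "Vector_Spaces.linear sB (*) \<phi>" "Vector_Spaces.linear sA sB g"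
  shows "Vector_Spaces.linear sA (*) (\<lambda>x. \<phi> (g x))"
  using assms by (simp add: Vector_Spaces.linear_iff)

lemma bilin_left:
  assumes "bilin sA sB f" "Vector_Spaces.linear s sA g"
  shows "Vector_Spaces.linear s (*) (\<lambda>x. f (g x) c)"
  using assms unfolding bilin_def by (auto intro: linear_functional_comp[where \<phi>="\<lambda>x. f x c"])

lemma bilin_right:
  assumes "bilin sA sB f" "Vector_Spaces.linear s sB g"
  shows "Vector_Spaces.linear s (*) (\<lambda>x. f c (g x))"
  using assms unfolding bilin_def by (auto intro: linear_functional_comp[where \<phi>="f c"])

lemma linear_scalar_left [multilinear]:
  assumes "Vector_Spaces.linear s (*) g"
  shows "Vector_Spaces.linear s (*) (\<lambda>x. c * g x)"
  using assms by (simp add: Vector_Spaces.linear_iff algebra_simps)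

lemma linear_scalar_right [multilinear]:
  assumes "Vector_Spaces.linear s (*) g"
  shows "Vector_Spaces.linear s (*) (\<lambda>x. g x * c)"
  using assms by (simp add: Vector_Spaces.linear_iff algebra_simps)

text \<open>The variable enters through the summand only. Tensors that themselves depend on it are
  handled by \<open>linear_coaction\<close> and \<open>linear_translation\<close>.\<close>

lemma linear_sw [multilinear]:
  assumes "\<And>a b. Vector_Spaces.linear s (*) (\<lambda>x. f x a b)"
  shows "Vector_Spaces.linear s (*) (\<lambda>x. sw t (\<lambda>a b. f x a b))"
  using assms unfolding ev_def lincomb_def case_prod_unfold
  by (simp add: Vector_Spaces.linear_iff algebra_simps sum.distrib sum_distrib_left)

lemmas [multilinear] = bilinI

lemma (in vector_space) linear_self [multilinear]: "Vector_Spaces.linear scale scale (\<lambda>x. x)"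
  by (simp add: Vector_Spaces.linear_iff vector_space_axioms)

context k_algebra
begin

lemma linear_times_right [multilinear]:
  assumes "Vector_Spaces.linear s' s g"
  shows "Vector_Spaces.linear s' s (\<lambda>x. g x * c)"
  using assms by (simp add: Vector_Spaces.linear_iff algebra_simps scale_mult_left)

lemma linear_times_left [multilinear]:
  assumes "Vector_Spaces.linear s' s g"
  shows "Vector_Spaces.linear s' s (\<lambda>x. c * g x)"
  using assms by (simp add: Vector_Spaces.linear_iff algebra_simps scale_mult_right)

end

lemma tensor_mult_sw:
  fixes sA :: "'k::field \<Rightarrow> 'a::{ring,monoid_mult} \<Rightarrow> 'a" and sB :: "'k \<Rightarrow> 'b::{ring,monoid_mult} \<Rightarrow> 'b"
  assumes A: "k_algebra sA" and B: "k_algebra sB"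
    and t: "t \<in> qspace (tensor_sub sA sB)" and u: "u \<in> qspace (tensor_sub sA sB)"
    and f: "bilin sA sB f"
  shows "sw (tensor_mult sA sB t u) f = sw t (\<lambda>a b. sw u (\<lambda>a' b'. f (a * a') (b * b')))"
proof -
  interpret A: k_algebra sA by (rule A)
  interpret B: k_algebra sB by (rule B)
  note vs = A.vector_space_axioms B.vector_space_axioms
  let ?U = "tensor_sub sA sB"
  have b: "bilin sA sB (\<lambda>a b. \<psi> (a, b))" if "annihilates \<psi> ?U" for \<psi> :: "_ \<Rightarrow> 'k"
    using that by (simp add: annihilates_tensor_sub[OF vs])
  note p = ev_pure and q = pure_in_qspace
  have b': "\<forall>\<psi>. annihilates \<psi> ?U \<longrightarrow> bilin sA sB (\<lambda>a' b'. ev \<psi> (pure sA sB (a * a') (b * b')))" for a b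
  proof (intro allI impI)
    fix \<psi> :: "_ \<Rightarrow> 'k" assume \<psi>: "annihilates \<psi> ?U"
    show "bilin sA sB (\<lambda>a' b'. ev \<psi> (pure sA sB (a * a') (b * b')))"
      unfolding p[OF \<psi>] by (intro multilinear bilin_left[OF b[OF \<psi>]] bilin_right[OF b[OF \<psi>]])
  qed
  note inner = tqsum_tensor[OF vs subspace_tensor_sub u q b']
  \<comment> \<open>The inner sum over \<open>u\<close>, once evaluated at a form, is again bilinear
    in \<open>a\<close> and \<open>b\<close>; this makes the outer sum independent of the
    representative of \<open>t\<close>.\<close>
  have b'': "\<forall>\<psi>. annihilates \<psi> ?U \<longrightarrow> bilin sA sB (\<lambda>a b. ev \<psi> (tqsum ?U u (\<lambda>a' b'. pure sA sB (a * a') (b * b'))))"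
  proof (intro allI impI)
    fix \<psi> :: "_ \<Rightarrow> 'k" assume \<psi>: "annihilates \<psi> ?U"
    show "bilin sA sB (\<lambda>a b. ev \<psi> (tqsum ?U u (\<lambda>a' b'. pure sA sB (a * a') (b * b'))))"
      unfolding inner(2)[OF \<psi>] p[OF \<psi>] by (intro multilinear bilin_left[OF b[OF \<psi>]] bilin_right[OF b[OF \<psi>]])
  qed
  have f': "annihilates (case_prod f) ?U" using f by (simp add: annihilates_tensor_sub[OF vs])
  note outer = tqsum_tensor[OF vs subspace_tensor_sub t inner(1) b'']
  show ?thesis
    unfolding tensor_mult_def outer(2)[OF f'] inner(2)[OF f'] p[OF f'] by simp
qed

section \<open>Comodule axioms as identities between scalar sums\<close>

context right_comodule
begin

lemma coaction_in_qspace: "\<Delta>M m \<in> qspace (tensor_sub sM sH)"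
  using coaction_linear by (simp add: qlinear_def)

lemma linear_coaction [multilinear]:
  assumes "bilin sM sH f" "Vector_Spaces.linear s sM g"
  shows "Vector_Spaces.linear s (*) (\<lambda>x. sw (\<Delta>M (g x)) f)"
proof (rule linear_functional_comp[OF _ assms(2)])
  show "Vector_Spaces.linear sM (*) (\<lambda>m. sw (\<Delta>M m) f)"
    by (rule ev_qlinear[OF subspace_tensor_sub coaction_linear _ M.vector_space_axioms])
      (simp add: annihilates_tensor_sub H.vector_space_axioms M.vector_space_axioms assms(1))
qed

text \<open>The locale does not constrain \<open>\<Delta>H\<close>, so its linearity is a hypothesis
  here. One lemma then serves both the coproduct and the coaction on \<open>P\<close>.\<close>

lemma sw_coassoc:
  assumes H: "qlinear sH (tensor_sub sH sH) \<Delta>H"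
    and f: "\<And>b c. Vector_Spaces.linear sM (*) (\<lambda>a. f a b c)"
      "\<And>a c. Vector_Spaces.linear sH (*) (\<lambda>b. f a b c)"
      "\<And>a b. Vector_Spaces.linear sH (*) (\<lambda>c. f a b c)"
  shows "sw (\<Delta>M m) (\<lambda>m' h2. sw (\<Delta>M m') (\<lambda>m0 h1. f m0 h1 h2)) =
    sw (\<Delta>M m) (\<lambda>m0 h. sw (\<Delta>H h) (\<lambda>h1 h2. f m0 h1 h2))"
proof -
  let ?U = "tensor3_sub sM sH sH"
  note vs = M.vector_space_axioms H.vector_space_axioms
  note U = subspace_tensor3_sub[of sM sH sH]
  have b: "Vector_Spaces.linear sM (*) (\<lambda>a. \<psi> (a, b, c))" "Vector_Spaces.linear sH (*) (\<lambda>b. \<psi> (a, b, c))"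
    "Vector_Spaces.linear sH (*) (\<lambda>c. \<psi> (a, b, c))"
    if "annihilates \<psi> ?U" for \<psi> :: "_ \<Rightarrow> 'k" and a b c
    using that by (simp_all add: annihilates_tensor3_sub[OF vs(1,2,2)])
  have p: "ev \<psi> (pure3 sM sH sH a b c) = \<psi> (a, b, c)" if "annihilates \<psi> ?U" for \<psi> :: "_ \<Rightarrow> 'k" and a b c
    unfolding pure3_def by (simp add: ev_qclass[OF U that])
  have q: "pure3 sM sH sH a b c \<in> qspace ?U" for a b c by (simp add: pure3_def)
  have bH: "\<forall>\<psi>. annihilates \<psi> ?U \<longrightarrow> bilin sH sH (\<lambda>h1 h2. ev \<psi> (pure3 sM sH sH a h1 h2))" for a
  proof (intro allI impI)
    fix \<psi> :: "_ \<Rightarrow> 'k" assume \<psi>: "annihilates \<psi> ?U"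
    show "bilin sH sH (\<lambda>h1 h2. ev \<psi> (pure3 sM sH sH a h1 h2))"
      unfolding p[OF \<psi>] by (intro bilinI b[OF \<psi>])
  qed
  have bM: "\<forall>\<psi>. annihilates \<psi> ?U \<longrightarrow> bilin sM sH (\<lambda>m0 h1. ev \<psi> (pure3 sM sH sH m0 h1 h2))" for h2
  proof (intro allI impI)
    fix \<psi> :: "_ \<Rightarrow> 'k" assume \<psi>: "annihilates \<psi> ?U"
    show "bilin sM sH (\<lambda>m0 h1. ev \<psi> (pure3 sM sH sH m0 h1 h2))"
      unfolding p[OF \<psi>] by (intro bilinI b[OF \<psi>])
  qed
  have HQ: "\<Delta>H h \<in> qspace (tensor_sub sH sH)" for h using H by (simp add: qlinear_def)
  have linH: "Vector_Spaces.linear sH (*) (\<lambda>h. sw (\<Delta>H h) g)" if "bilin sH sH g" for g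
    by (rule ev_qlinear[OF subspace_tensor_sub H _ vs(2)])
      (simp add: annihilates_tensor_sub[OF vs(2,2)] that)
  note innerH = tqsum_tensor[OF vs(2,2) U HQ q bH]
  note innerM = tqsum_tensor[OF vs U coaction_in_qspace q bM]
  have oH: "\<forall>\<psi>. annihilates \<psi> ?U \<longrightarrow> bilin sM sH (\<lambda>m0 h. ev \<psi> (tqsum ?U (\<Delta>H h) (\<lambda>h1 h2. pure3 sM sH sH m0 h1 h2)))"
  proof (intro allI impI)
    fix \<psi> :: "_ \<Rightarrow> 'k" assume \<psi>: "annihilates \<psi> ?U"
    show "bilin sM sH (\<lambda>m0 h. ev \<psi> (tqsum ?U (\<Delta>H h) (\<lambda>h1 h2. pure3 sM sH sH m0 h1 h2)))"
      unfolding innerH(2)[OF \<psi>] p[OF \<psi>] by (intro bilinI linH linear_sw b[OF \<psi>])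
  qed
  have oM: "\<forall>\<psi>. annihilates \<psi> ?U \<longrightarrow> bilin sM sH (\<lambda>m' h2. ev \<psi> (tqsum ?U (\<Delta>M m') (\<lambda>m0 h1. pure3 sM sH sH m0 h1 h2)))"
  proof (intro allI impI)
    fix \<psi> :: "_ \<Rightarrow> 'k" assume \<psi>: "annihilates \<psi> ?U"
    show "bilin sM sH (\<lambda>m' h2. ev \<psi> (tqsum ?U (\<Delta>M m') (\<lambda>m0 h1. pure3 sM sH sH m0 h1 h2)))"
      unfolding innerM(2)[OF \<psi>] p[OF \<psi>]
      by (intro bilinI linear_coaction[where g="\<lambda>x. x"] M.linear_self linear_sw b[OF \<psi>])
  qed
  have f': "annihilates (\<lambda>(a, b, c). f a b c) ?U"
    using f by (simp add: annihilates_tensor3_sub[OF vs(1,2,2)])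
  note outerH = tqsum_tensor[OF vs U coaction_in_qspace innerH(1) oH]
  note outerM = tqsum_tensor[OF vs U coaction_in_qspace innerM(1) oM]
  show ?thesis
    using arg_cong[OF coaction_coassoc[of m], of "ev (\<lambda>(a, b, c). f a b c)"]
    unfolding outerH(2)[OF f'] outerM(2)[OF f'] innerH(2)[OF f'] innerM(2)[OF f'] p[OF f'] by simp
qed

lemma sw_counit:
  assumes \<epsilon>: "Vector_Spaces.linear sH (*) \<epsilon>" and \<phi>: "Vector_Spaces.linear sM (*) \<phi>"
  shows "sw (\<Delta>M m) (\<lambda>m0 m1. \<epsilon> m1 * \<phi> m0) = \<phi> m"
proof -
  have *: "\<psi> (sM (\<epsilon> m1) m0) = \<epsilon> m1 * \<psi> m0" if "Vector_Spaces.linear sM (*) \<psi>" for \<psi> :: "_ \<Rightarrow> 'k" and m0 m1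
    using that by (rule linear_scaleD)
  have "\<phi> (tsum sM (\<Delta>M m) (\<lambda>m0 m1. sM (\<epsilon> m1) m0)) = sw (\<Delta>M m) (\<lambda>m0 m1. \<phi> (sM (\<epsilon> m1) m0))"
    by (rule tsum_tensor[OF M.vector_space_axioms H.vector_space_axioms M.vector_space_axioms coaction_in_qspace _ \<phi>])
      (simp add: *, intro multilinear \<epsilon>, assumption)
  then show ?thesis by (simp add: coaction_counit *[OF \<phi>])
qed

end

section \<open>The antipode reverses products and coproducts\<close>

context hopf_algebra
begin

lemma linear_counit [multilinear]:
  assumes "Vector_Spaces.linear s' s g"
  shows "Vector_Spaces.linear s' (*) (\<lambda>x. \<epsilon> (g x))"
  using assms counit_linear by (simp add: Vector_Spaces.linear_iff)

lemma linear_antipode [multilinear]: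
  assumes "Vector_Spaces.linear s' s g"
  shows "Vector_Spaces.linear s' s (\<lambda>x. S (g x))"
  using assms antipode_linear by (simp add: Vector_Spaces.linear_iff)

lemmas comult_in_qspace = coaction_in_qspace

lemmas sw_comult_coassoc = sw_coassoc[OF coaction_linear]

lemmas sw_counit_right = sw_counit[OF counit_linear]

lemma comult_functional:
  assumes "\<And>\<psi>. Vector_Spaces.linear s (*) \<psi> \<Longrightarrow> bilin s s (\<lambda>a b. \<psi> (f a b))"
    and "Vector_Spaces.linear s (*) \<phi>"
  shows "\<phi> (tsum s (\<Delta> h) f) = sw (\<Delta> h) (\<lambda>a b. \<phi> (f a b))"
  by (rule tsum_tensor[OF vector_space_axioms vector_space_axioms vector_space_axioms comult_in_qspace assms])

lemma sw_counit_left: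
  assumes \<phi>: "Vector_Spaces.linear s (*) \<phi>"
  shows "sw (\<Delta> h) (\<lambda>h1 h2. \<epsilon> h1 * \<phi> h2) = \<phi> h"
proof -
  have "\<phi> (tsum s (\<Delta> h) (\<lambda>h1 h2. s (\<epsilon> h1) h2)) = sw (\<Delta> h) (\<lambda>h1 h2. \<phi> (s (\<epsilon> h1) h2))"
    by (rule comult_functional[OF _ \<phi>])
      (simp add: linear_scaleD, intro multilinear, assumption)
  then show ?thesis by (simp add: counit_left linear_scaleD[OF \<phi>])
qed

lemma sw_antipode_left:
  assumes \<phi>: "Vector_Spaces.linear s (*) \<phi>"
  shows "sw (\<Delta> h) (\<lambda>a b. \<phi> (S a * b)) = \<epsilon> h * \<phi> 1"
proof -
  have "\<phi> (tsum s (\<Delta> h) (\<lambda>a b. S a * b)) = sw (\<Delta> h) (\<lambda>a b. \<phi> (S a * b))"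
  proof (rule comult_functional[OF _ \<phi>])
    fix \<psi> assume \<psi>: "Vector_Spaces.linear s (*) \<psi>"
    show "bilin s s (\<lambda>a b. \<psi> (S a * b))"
      by (intro multilinear linear_functional_comp[OF \<psi>])
  qed
  then show ?thesis by (simp add: antipode_left linear_scaleD[OF \<phi>])
qed

lemma sw_antipode_right:
  assumes \<phi>: "Vector_Spaces.linear s (*) \<phi>"
  shows "sw (\<Delta> h) (\<lambda>a b. \<phi> (a * S b)) = \<epsilon> h * \<phi> 1"
proof -
  have "\<phi> (tsum s (\<Delta> h) (\<lambda>a b. a * S b)) = sw (\<Delta> h) (\<lambda>a b. \<phi> (a * S b))"
  proof (rule comult_functional[OF _ \<phi>])
    fix \<psi> assume \<psi>: "Vector_Spaces.linear s (*) \<psi>"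
    show "bilin s s (\<lambda>a b. \<psi> (a * S b))"
      by (intro multilinear linear_functional_comp[OF \<psi>])
  qed
  then show ?thesis by (simp add: antipode_right linear_scaleD[OF \<phi>])
qed

lemma sw_comult_mult:
  "bilin s s f \<Longrightarrow> sw (\<Delta> (g * h)) f = sw (\<Delta> g) (\<lambda>a b. sw (\<Delta> h) (\<lambda>c d. f (a * c) (b * d)))"
  unfolding comult_mult
  by (rule tensor_mult_sw[OF k_algebra_axioms k_algebra_axioms comult_in_qspace comult_in_qspace])

lemma sw_comult_one: "bilin s s f \<Longrightarrow> sw (\<Delta> 1) f = f 1 1"
  by (simp add: comult_one sw_pure vector_space_axioms)

lemma antipode_one: "S 1 = 1"
proof (rule eqI_functionals)
  fix \<phi> assume \<phi>: "Vector_Spaces.linear s (*) \<phi>"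
  note [multilinear] = linear_functional_comp[OF \<phi>]
  have "sw (\<Delta> 1) (\<lambda>a b. \<phi> (S a * b)) = \<phi> (S 1 * 1)"
    by (rule sw_comult_one) (intro multilinear)
  then show "\<phi> (S 1) = \<phi> 1" by (simp add: sw_antipode_left[OF \<phi>] counit_one)
qed

text \<open>Uniqueness of convolution inverses: S(xy) and S(y)S(x) are both inverse to
  multiplication. The sum of S(x1 y1) x2 y2 S(y3) S(x3) collapses to the first from the right and to
  the second from the left.\<close>

lemma antipode_mult: "S (x * y) = S y * S x"
proof (rule eqI_functionals)
  fix \<phi> assume \<phi>: "Vector_Spaces.linear s (*) \<phi>"
  note [multilinear] = linear_functional_comp[OF \<phi>]
  let ?F = "\<lambda>x1 x2 x3 y1 y2 y3. \<phi> (S (x1 * y1) * (x2 * (y2 * (S y3 * S x3))))"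
  let ?\<Phi> = "sw (\<Delta> x) (\<lambda>x1 x'. sw (\<Delta> x') (\<lambda>x2 x3. sw (\<Delta> y) (\<lambda>y1 y'. sw (\<Delta> y') (\<lambda>y2 y3.
    ?F x1 x2 x3 y1 y2 y3))))"
  have a1: "sw (\<Delta> y') (\<lambda>y2 y3. ?F x1 x2 x3 y1 y2 y3) = \<epsilon> y' * \<phi> (S (x1 * y1) * (x2 * S x3))"
    for y' y1 x1 x2 x3
    using sw_antipode_right[of "\<lambda>z. \<phi> (S (x1 * y1) * (x2 * (z * S x3)))" y']
    by (simp add: mult.assoc) (erule meta_mp, intro multilinear)
  have a2: "sw (\<Delta> y) (\<lambda>y1 y'. \<epsilon> y' * \<phi> (S (x1 * y1) * (x2 * S x3))) = \<phi> (S (x1 * y) * (x2 * S x3))"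
    for x1 x2 x3
    by (rule sw_counit_right[of "\<lambda>z. \<phi> (S (x1 * z) * (x2 * S x3))"]) (intro multilinear)
  have a3: "sw (\<Delta> x') (\<lambda>x2 x3. \<phi> (S (x1 * y) * (x2 * S x3))) = \<epsilon> x' * \<phi> (S (x1 * y))" for x' x1
    using sw_antipode_right[of "\<lambda>z. \<phi> (S (x1 * y) * z)" x']
    by simp (erule meta_mp, intro multilinear)
  have a4: "sw (\<Delta> x) (\<lambda>x1 x'. \<epsilon> x' * \<phi> (S (x1 * y))) = \<phi> (S (x * y))"
    by (rule sw_counit_right[of "\<lambda>z. \<phi> (S (z * y))"]) (intro multilinear)
  have A: "?\<Phi> = \<phi> (S (x * y))"
    by (simp only: a1 a2 a3 a4)
  \<comment> \<open>Coassociativity in \<open>y\<close> and then in \<open>x\<close> now pairs the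
    first two legs, so that S(x1 y1) x2 y2 becomes the antipode identity for a product.\<close>
  have c1: "sw (\<Delta> y) (\<lambda>y1 y'. sw (\<Delta> y') (\<lambda>y2 y3. ?F x1 x2 x3 y1 y2 y3)) =
      sw (\<Delta> y) (\<lambda>y' y3. sw (\<Delta> y') (\<lambda>y1 y2. ?F x1 x2 x3 y1 y2 y3))" for x1 x2 x3
    by (rule sw_comult_coassoc[symmetric]; intro multilinear)
  have c2: "sw (\<Delta> x) (\<lambda>x1 x'. sw (\<Delta> x') (\<lambda>x2 x3. sw (\<Delta> y) (\<lambda>y' y3. sw (\<Delta> y') (\<lambda>y1 y2. ?F x1 x2 x3 y1 y2 y3)))) =
      sw (\<Delta> x) (\<lambda>x' x3. sw (\<Delta> x') (\<lambda>x1 x2. sw (\<Delta> y) (\<lambda>y' y3. sw (\<Delta> y') (\<lambda>y1 y2. ?F x1 x2 x3 y1 y2 y3))))"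
    by (rule sw_comult_coassoc[symmetric]; intro multilinear)
  have c3: "sw (\<Delta> x') (\<lambda>x1 x2. sw (\<Delta> y) (\<lambda>y' y3. sw (\<Delta> y') (\<lambda>y1 y2. ?F x1 x2 x3 y1 y2 y3))) =
      sw (\<Delta> y) (\<lambda>y' y3. sw (\<Delta> x') (\<lambda>x1 x2. sw (\<Delta> y') (\<lambda>y1 y2. ?F x1 x2 x3 y1 y2 y3)))" for x' x3
    by (rule sw_commute)
  have b1: "sw (\<Delta> x') (\<lambda>x1 x2. sw (\<Delta> y') (\<lambda>y1 y2. ?F x1 x2 x3 y1 y2 y3)) = \<epsilon> x' * (\<epsilon> y' * \<phi> (S y3 * S x3))"
    for x' y' x3 y3
  proof -
    have "sw (\<Delta> (x' * y')) (\<lambda>a b. \<phi> (S a * b * (S y3 * S x3))) = \<epsilon> (x' * y') * \<phi> (1 * (S y3 * S x3))"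
      by (rule sw_antipode_left) (intro multilinear)
    moreover have "sw (\<Delta> (x' * y')) (\<lambda>a b. \<phi> (S a * b * (S y3 * S x3))) =
      sw (\<Delta> x') (\<lambda>x1 x2. sw (\<Delta> y') (\<lambda>y1 y2. \<phi> (S (x1 * y1) * (x2 * y2) * (S y3 * S x3))))"
      by (rule sw_comult_mult) (intro multilinear)
    ultimately show ?thesis by (simp add: mult.assoc counit_mult)
  qed
  have b2: "sw (\<Delta> y) (\<lambda>y' y3. \<epsilon> x' * (\<epsilon> y' * \<phi> (S y3 * S x3))) = \<epsilon> x' * \<phi> (S y * S x3)" for x' x3
    unfolding sw_mult_left
    by (subst sw_counit_left[of "\<lambda>z. \<phi> (S z * S x3)"]) (intro multilinear refl)+
  have b3: "sw (\<Delta> x) (\<lambda>x' x3. \<epsilon> x' * \<phi> (S y * S x3)) = \<phi> (S y * S x)"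
    by (rule sw_counit_left[of "\<lambda>z. \<phi> (S y * S z)"]) (intro multilinear)
  have B: "?\<Phi> = \<phi> (S y * S x)"
    by (simp only: c1 c2 c3 b1 b2 b3)
  show "\<phi> (S (x * y)) = \<phi> (S y * S x)" using A B by simp
qed

text \<open>Again two convolution inverses, now of the coproduct as a map from H to H tensor H. The
  sum of \<open>\<Delta> (S h1)\<close>, \<open>\<Delta> h2\<close> and the flipped antipodes of the
  legs of \<open>h3\<close> is collapsed in two ways.\<close>

lemma sw_comult_antipode:
  assumes \<beta>: "bilin s s \<beta>"
  shows "sw (\<Delta> (S h)) \<beta> = sw (\<Delta> h) (\<lambda>a b. \<beta> (S b) (S a))"
proof -
  note [multilinear] = bilin_left[OF \<beta>] bilin_right[OF \<beta>]
  let ?F = "\<lambda>u v a b c d. \<beta> (u * (a * S d)) (v * (b * S c))"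
  let ?\<Phi> = "sw (\<Delta> h) (\<lambda>h1 h'. sw (\<Delta> h') (\<lambda>h2 h3. sw (\<Delta> (S h1)) (\<lambda>u v.
    sw (\<Delta> h2) (\<lambda>a b. sw (\<Delta> h3) (\<lambda>c d. ?F u v a b c d)))))"
  have A1: "sw (\<Delta> h') (\<lambda>h2 h3. sw (\<Delta> h2) (\<lambda>a b. sw (\<Delta> h3) (\<lambda>c d. ?F u v a b c d))) = \<epsilon> h' * \<beta> u v"
    for h' u v
  proof -
    have "sw (\<Delta> h') (\<lambda>p q. sw (\<Delta> p) (\<lambda>a b. sw (\<Delta> q) (\<lambda>c d. ?F u v a b c d))) =
        sw (\<Delta> h') (\<lambda>a r. sw (\<Delta> r) (\<lambda>b q. sw (\<Delta> q) (\<lambda>c d. ?F u v a b c d)))"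
      by (rule sw_comult_coassoc; intro multilinear)
    \<comment> \<open>The middle legs \<open>b\<close> and \<open>c\<close> become the two legs of
      one coproduct, so \<open>b * S c\<close> cancels first and \<open>a * S d\<close>
      afterwards.\<close>
    also have "\<dots> = sw (\<Delta> h') (\<lambda>a r. sw (\<Delta> r) (\<lambda>t d. sw (\<Delta> t) (\<lambda>b c. ?F u v a b c d)))"
      by (subst sw_comult_coassoc; (intro multilinear)?; rule refl)
    also have "\<dots> = sw (\<Delta> h') (\<lambda>a r. sw (\<Delta> r) (\<lambda>t d. \<epsilon> t * \<beta> (u * (a * S d)) v))"
    proof -
      have "sw (\<Delta> t) (\<lambda>b c. ?F u v a b c d) = \<epsilon> t * \<beta> (u * (a * S d)) (v * 1)" for a d t
        by (rule sw_antipode_right[of "\<lambda>z. \<beta> (u * (a * S d)) (v * z)"]) (intro multilinear)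
      then show ?thesis by simp
    qed
    also have "\<dots> = sw (\<Delta> h') (\<lambda>a d. \<beta> (u * (a * S d)) v)"
    proof -
      have "sw (\<Delta> r) (\<lambda>t d. \<epsilon> t * \<beta> (u * (a * S d)) v) = \<beta> (u * (a * S r)) v" for a r
        by (rule sw_counit_left[of "\<lambda>z. \<beta> (u * (a * S z)) v"]) (intro multilinear)
      then show ?thesis by simp
    qed
    also have "\<dots> = \<epsilon> h' * \<beta> (u * 1) v"
      by (rule sw_antipode_right[of "\<lambda>z. \<beta> (u * z) v"]) (intro multilinear)
    finally show ?thesis by simp
  qed
  have "?\<Phi> = sw (\<Delta> h) (\<lambda>h1 h'. sw (\<Delta> (S h1)) (\<lambda>u v. \<epsilon> h' * \<beta> u v))"
    by (subst sw_commute) (simp only: A1)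
  also have "\<dots> = sw (\<Delta> (S h)) \<beta>"
    unfolding sw_mult_left
    by (rule sw_counit_right[of "\<lambda>z. sw (\<Delta> (S z)) \<beta>"]) (intro multilinear)
  finally have A: "?\<Phi> = sw (\<Delta> (S h)) \<beta>" .
  have "?\<Phi> = sw (\<Delta> h) (\<lambda>h' h3. sw (\<Delta> h') (\<lambda>h1 h2. sw (\<Delta> (S h1)) (\<lambda>u v.
      sw (\<Delta> h2) (\<lambda>a b. sw (\<Delta> h3) (\<lambda>c d. ?F u v a b c d)))))"
    by (rule sw_comult_coassoc[symmetric]; intro multilinear)
  also have "\<dots> = sw (\<Delta> h) (\<lambda>h' h3. \<epsilon> h' * sw (\<Delta> h3) (\<lambda>c d. \<beta> (S d) (S c)))"
  proof -
    \<comment> \<open>The coproduct is multiplicative, so its values at \<open>S h1\<close> and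
      \<open>h2\<close> combine before the antipode identity is applied.\<close>
    have *: "sw (\<Delta> (S h1 * h2)) (\<lambda>p q. sw (\<Delta> h3) (\<lambda>c d. \<beta> (p * S d) (q * S c))) =
        sw (\<Delta> (S h1)) (\<lambda>u v. sw (\<Delta> h2) (\<lambda>a b. sw (\<Delta> h3) (\<lambda>c d. \<beta> (u * a * S d) (v * b * S c))))" for h1 h2 h3
      by (rule sw_comult_mult) (intro multilinear)
    have "sw (\<Delta> h') (\<lambda>h1 h2. sw (\<Delta> (S h1 * h2)) (\<lambda>p q. sw (\<Delta> h3) (\<lambda>c d. \<beta> (p * S d) (q * S c)))) =
        \<epsilon> h' * sw (\<Delta> 1) (\<lambda>p q. sw (\<Delta> h3) (\<lambda>c d. \<beta> (p * S d) (q * S c)))" for h' h3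
      by (rule sw_antipode_left) (intro multilinear)
    moreover have "sw (\<Delta> 1) (\<lambda>p q. sw (\<Delta> h3) (\<lambda>c d. \<beta> (p * S d) (q * S c))) =
        sw (\<Delta> h3) (\<lambda>c d. \<beta> (1 * S d) (1 * S c))" for h3
      by (rule sw_comult_one) (intro multilinear)
    ultimately show ?thesis by (simp add: * mult.assoc)
  qed
  also have "\<dots> = sw (\<Delta> h) (\<lambda>c d. \<beta> (S d) (S c))"
    by (rule sw_counit_left[of "\<lambda>z. sw (\<Delta> z) (\<lambda>c d. \<beta> (S d) (S c))"]) (intro multilinear)
  finally show ?thesis using A by simp
qed

end

section \<open>The inverse antipode\<close>

locale hopf_algebra_bij = hopf_algebra +
  assumes bij_antipode: "bij S"
begin

abbreviation R where "R \<equiv> inv S"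

lemma antipode_inv [simp]: "S (R h) = h" "R (S h) = h"
  using bij_antipode by (simp_all add: bij_is_surj surj_f_inv_f bij_is_inj)

lemma inv_antipode_eqI: "S x = h \<Longrightarrow> R h = x"
  by auto

lemma linear_inv_antipode [multilinear]:
  assumes "Vector_Spaces.linear s' s g"
  shows "Vector_Spaces.linear s' s (\<lambda>x. R (g x))"
proof -
  have "R (x + y) = R x + R y" "R (s c x) = s c (R x)" for x y c
    by (auto intro!: inv_antipode_eqI simp: linear_addD[OF antipode_linear] linear_scaleD[OF antipode_linear])
  then show ?thesis using assms by (simp add: Vector_Spaces.linear_iff)
qed

lemma inv_antipode_one: "R 1 = 1"
  by (rule inv_antipode_eqI) (rule antipode_one)

lemma inv_antipode_mult: "R (x * y) = R y * R x"
  by (rule inv_antipode_eqI) (simp add: antipode_mult)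

lemma sw_comult_inv_antipode:
  assumes \<beta>: "bilin s s \<beta>"
  shows "sw (\<Delta> (R h)) \<beta> = sw (\<Delta> h) (\<lambda>a b. \<beta> (R b) (R a))"
proof -
  note [multilinear] = bilin_left[OF \<beta>] bilin_right[OF \<beta>]
  have "sw (\<Delta> (S (R h))) (\<lambda>u v. \<beta> (R v) (R u)) = sw (\<Delta> (R h)) (\<lambda>a b. \<beta> (R (S a)) (R (S b)))"
    by (rule sw_comult_antipode) (intro multilinear)
  then show ?thesis by simp
qed

text \<open>Apply the antimultiplicative map \<open>R\<close> to the left antipode identity:
  \<open>R (S a * b)\<close> is \<open>R b * a\<close>.\<close>

lemma sw_inv_antipode:
  assumes \<phi>: "Vector_Spaces.linear s (*) \<phi>"
  shows "sw (\<Delta> h) (\<lambda>a b. \<phi> (R b * a)) = \<epsilon> h * \<phi> 1"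
proof -
  note [multilinear] = linear_functional_comp[OF \<phi>]
  have "sw (\<Delta> h) (\<lambda>a b. \<phi> (R (S a * b))) = \<epsilon> h * \<phi> (R 1)"
    by (rule sw_antipode_left) (intro multilinear)
  then show ?thesis by (simp add: inv_antipode_mult inv_antipode_one)
qed

end

section \<open>The translation map\<close>

context right_comodule_algebra
begin

lemma sw_coaction_mult:
  "bilin sP sH f \<Longrightarrow>
    sw (\<Delta>P (p * q)) f = sw (\<Delta>P p) (\<lambda>p0 p1. sw (\<Delta>P q) (\<lambda>q0 q1. f (p0 * q0) (p1 * q1)))"
  unfolding coaction_mult
  by (rule tensor_mult_sw[OF P.k_algebra_axioms H.k_algebra_axioms coaction_in_qspace coaction_in_qspace])

lemma sw_coaction_one: "bilin sP sH f \<Longrightarrow> sw (\<Delta>P 1) f = f 1 1"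
  by (simp add: coaction_one sw_pure P.vector_space_axioms H.vector_space_axioms)

lemmas sw_coaction_coassoc = sw_coassoc[OF H.coaction_linear]

lemmas sw_coaction_counit = sw_counit[OF H.counit_linear]

abbreviation "B \<equiv> coinvariants sH sP \<Delta>P"

text \<open>The coaction is multiplicative and sends \<open>b\<close> to b tensor 1, so it is linear
  over \<open>B\<close> on both sides.\<close>

lemma sw_coaction_times_coinvariant:
  assumes b: "b \<in> B" and f: "bilin sP sH f"
  shows "sw (\<Delta>P (p * b)) f = sw (\<Delta>P p) (\<lambda>p0 p1. f (p0 * b) p1)"
    and "sw (\<Delta>P (b * p)) f = sw (\<Delta>P p) (\<lambda>p0 p1. f (b * p0) p1)"
proof -
  note [multilinear] = bilin_left[OF f] bilin_right[OF f]
  have b': "sw (\<Delta>P b) g = g b 1" if "bilin sP sH g" for g :: "'p \<Rightarrow> 'h \<Rightarrow> 'k"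
    using b that by (simp add: coinvariants_def sw_pure P.vector_space_axioms H.vector_space_axioms)
  have "sw (\<Delta>P b) (\<lambda>b0 b1. f (p0 * b0) (p1 * b1)) = f (p0 * b) (p1 * 1)" for p0 p1
    by (rule b') (intro multilinear)
  then show "sw (\<Delta>P (p * b)) f = sw (\<Delta>P p) (\<lambda>p0 p1. f (p0 * b) p1)"
    by (simp add: sw_coaction_mult[OF f])
  have "sw (\<Delta>P b) (\<lambda>b0 b1. sw (\<Delta>P p) (\<lambda>p0 p1. f (b0 * p0) (b1 * p1))) =
      sw (\<Delta>P p) (\<lambda>p0 p1. f (b * p0) (1 * p1))"
    by (rule b') (intro multilinear)
  then show "sw (\<Delta>P (b * p)) f = sw (\<Delta>P p) (\<lambda>p0 p1. f (b * p0) p1)"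
    by (simp add: sw_coaction_mult[OF f])
qed

text \<open>These are the linear forms on the tensor product of \<open>P\<close> with itself over
  \<open>B\<close>, written as functions of two variables.\<close>

definition balanced :: "('p \<Rightarrow> 'p \<Rightarrow> 'k) \<Rightarrow> bool" where
  "balanced f \<longleftrightarrow> bilin sP sP f \<and> (\<forall>p b p'. b \<in> B \<longrightarrow> f (p * b) p' = f p (b * p'))"

lemma balancedI:
  assumes "bilin sP sP f" "\<And>p b p'. b \<in> B \<Longrightarrow> f (p * b) p' = f p (b * p')"
  shows "balanced f"
  using assms by (simp add: balanced_def)

lemma balanced_bilin: "balanced f \<Longrightarrow> bilin sP sP f"
  by (simp add: balanced_def)

lemma annihilates_balanced: "annihilates f (balanced_sub sP B) \<longleftrightarrow> balanced (\<lambda>a b. f (a, b))"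
  by (simp add: annihilates_balanced_sub[OF P.vector_space_axioms] balanced_def)

lemma balanced_times_left:
  assumes f: "balanced f"
  shows "balanced (\<lambda>a b. f (x * a) b)"
proof (rule balancedI)
  note [multilinear] = bilin_left[OF balanced_bilin[OF f]] bilin_right[OF balanced_bilin[OF f]]
  show "bilin sP sP (\<lambda>a b. f (x * a) b)"
    by (intro multilinear)
  show "f (x * (p * b)) p' = f (x * p) (b * p')" if "b \<in> B" for p b p'
    using f that by (simp add: balanced_def flip: mult.assoc)
qed

lemma can_map_sw:
  assumes t: "t \<in> tensor_over_coinvariants sH sP \<Delta>P"
  shows can_map_in_qspace: "can_map sH sP \<Delta>P t \<in> qspace (tensor_sub sP sH)"
    and "bilin sP sH \<beta> \<Longrightarrow> sw (can_map sH sP \<Delta>P t) \<beta> =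
      sw t (\<lambda>p p'. sw (\<Delta>P p') (\<lambda>p0 p1. \<beta> (p * p0) p1))"
proof -
  let ?U = "tensor_sub sP sH"
  note vs = P.vector_space_axioms H.vector_space_axioms
  have b: "bilin sP sH (\<lambda>a b. \<psi> (a, b))" if "annihilates \<psi> ?U" for \<psi> :: "_ \<Rightarrow> 'k"
    using that by (simp add: annihilates_tensor_sub[OF vs])
  note p = ev_pure and q = pure_in_qspace
  have b': "\<forall>\<psi>. annihilates \<psi> ?U \<longrightarrow> bilin sP sH (\<lambda>p0 p1. ev \<psi> (pure sP sH (x * p0) p1))" for x
  proof (intro allI impI)
    fix \<psi> :: "_ \<Rightarrow> 'k" assume \<psi>: "annihilates \<psi> ?U"
    show "bilin sP sH (\<lambda>p0 p1. ev \<psi> (pure sP sH (x * p0) p1))"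
      unfolding p[OF \<psi>] by (intro multilinear bilin_left[OF b[OF \<psi>]] bilin_right[OF b[OF \<psi>]])
  qed
  note inner = tqsum_tensor[OF vs subspace_tensor_sub coaction_in_qspace q b']
  \<comment> \<open>This is the well-definedness of the canonical map over \<open>B\<close>: left
    \<open>B\<close>-linearity of the coaction moves \<open>c\<close> across the tensor
    sign.\<close>
  have ann: "annihilates (\<lambda>(x, y). ev \<psi> (tqsum ?U (\<Delta>P y) (\<lambda>p0 p1. pure sP sH (x * p0) p1))) (balanced_sub sP B)"
    if \<psi>: "annihilates \<psi> ?U" for \<psi> :: "_ \<Rightarrow> 'k"
  proof -
    note [multilinear] = bilin_left[OF b[OF \<psi>]] bilin_right[OF b[OF \<psi>]]
    have "balanced (\<lambda>x y. sw (\<Delta>P y) (\<lambda>p0 p1. \<psi> (x * p0, p1)))"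
    proof (rule balancedI)
      show "bilin sP sP (\<lambda>x y. sw (\<Delta>P y) (\<lambda>p0 p1. \<psi> (x * p0, p1)))"
        by (intro multilinear)
      fix x c y assume c: "c \<in> B"
      have "sw (\<Delta>P (c * y)) (\<lambda>p0 p1. \<psi> (x * p0, p1)) = sw (\<Delta>P y) (\<lambda>p0 p1. \<psi> (x * (c * p0), p1))"
        by (rule sw_coaction_times_coinvariant(2)[OF c]) (intro multilinear)
      then show "sw (\<Delta>P y) (\<lambda>p0 p1. \<psi> (x * c * p0, p1)) = sw (\<Delta>P (c * y)) (\<lambda>p0 p1. \<psi> (x * p0, p1))"
        by (simp add: mult.assoc)
    qed
    then show ?thesis
      unfolding annihilates_balanced by (simp add: inner(2)[OF \<psi>] p[OF \<psi>])
  qed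
  note t' = t[unfolded tensor_over_coinvariants_def]
  show "can_map sH sP \<Delta>P t \<in> qspace ?U"
    unfolding can_map_def by (rule tqsum_functional(1)[OF subspace_balanced_sub subspace_tensor_sub t' inner(1) ann])
  assume "bilin sP sH \<beta>"
  then have \<beta>: "annihilates (case_prod \<beta>) ?U" by (simp add: annihilates_tensor_sub[OF vs])
  have "ev (case_prod \<beta>) (can_map sH sP \<Delta>P t) =
      sw t (\<lambda>x y. ev (case_prod \<beta>) (tqsum ?U (\<Delta>P y) (\<lambda>p0 p1. pure sP sH (x * p0) p1)))"
    unfolding can_map_def
    by (rule tqsum_functional(2)[OF subspace_balanced_sub subspace_tensor_sub t' inner(1) ann \<beta>])
  then show "sw (can_map sH sP \<Delta>P t) \<beta> = sw t (\<lambda>p p'. sw (\<Delta>P p') (\<lambda>p0 p1. \<beta> (p * p0) p1))"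
    by (simp add: inner(2)[OF \<beta>] p[OF \<beta>])
qed

end

section \<open>The translation map tested on balanced forms\<close>

context hopf_galois_extension
begin

abbreviation "T \<equiv> translation_map sH sP \<Delta>P"

lemma translation_map_in: "T h \<in> tensor_over_coinvariants sH sP \<Delta>P"
  and can_translation_map: "can_map sH sP \<Delta>P (T h) = pure sP sH 1 h"
proof -
  have im: "can_map sH sP \<Delta>P ` tensor_over_coinvariants sH sP \<Delta>P = qspace (tensor_sub sP sH)"
    using can_bij by (simp add: bij_betw_def)
  have "pure sP sH 1 h \<in> can_map sH sP \<Delta>P ` tensor_over_coinvariants sH sP \<Delta>P"
    unfolding im by (rule pure_in_qspace)
  then show "T h \<in> tensor_over_coinvariants sH sP \<Delta>P"
    and "can_map sH sP \<Delta>P (T h) = pure sP sH 1 h"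
    unfolding translation_map_def by (rule inv_into_into, rule f_inv_into_f)
qed

text \<open>The canonical map sends \<open>T h\<close> to 1 tensor h; this is that identity paired
  with an arbitrary bilinear form.\<close>

lemma sw_translation:
  assumes "bilin sP sH \<beta>"
  shows "sw (T h) (\<lambda>x y. sw (\<Delta>P y) (\<lambda>y0 y1. \<beta> (x * y0) y1)) = \<beta> 1 h"
  using can_map_sw(2)[OF translation_map_in assms, of h]
  by (simp add: can_translation_map sw_pure[OF P.vector_space_axioms H.vector_space_axioms assms])

text \<open>Injectivity of the canonical map in dual form. \<open>X\<close> and \<open>Y\<close> are
  formal sums rather than cosets, so explicitly constructed elements can be compared
  directly.\<close>

lemma can_injective:
  assumes eq: "\<And>\<beta>. bilin sP sH \<beta> \<Longrightarrow>
      lincomb (*) (\<lambda>(x, y). sw (\<Delta>P y) (\<lambda>y0 y1. \<beta> (x * y0) y1)) X =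
      lincomb (*) (\<lambda>(x, y). sw (\<Delta>P y) (\<lambda>y0 y1. \<beta> (x * y0) y1)) Y"
    and f: "balanced (\<lambda>x y. f (x, y))"
  shows "lincomb (*) f X = lincomb (*) f Y"
proof -
  let ?V = "balanced_sub sP B"
  let ?q = "qclass ?V"
  have f': "annihilates f ?V" using f by (simp add: annihilates_balanced)
  have in': "?q Z \<in> tensor_over_coinvariants sH sP \<Delta>P" for Z
    by (simp add: tensor_over_coinvariants_def)
  have "can_map sH sP \<Delta>P (?q X) = can_map sH sP \<Delta>P (?q Y)"
  proof (rule tensor_eqI[OF P.vector_space_axioms H.vector_space_axioms
        can_map_in_qspace[OF in'] can_map_in_qspace[OF in']])
    fix \<beta> assume \<beta>: "bilin sP sH \<beta>"
    note [multilinear] = bilin_left[OF \<beta>] bilin_right[OF \<beta>]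
    have "balanced (\<lambda>x y. sw (\<Delta>P y) (\<lambda>y0 y1. \<beta> (x * y0) y1))"
    proof (rule balancedI)
      show "bilin sP sP (\<lambda>x y. sw (\<Delta>P y) (\<lambda>y0 y1. \<beta> (x * y0) y1))"
        by (intro multilinear)
      fix x c y assume c: "c \<in> B"
      have "sw (\<Delta>P (c * y)) (\<lambda>p0 p1. \<beta> (x * p0) p1) = sw (\<Delta>P y) (\<lambda>p0 p1. \<beta> (x * (c * p0)) p1)"
        by (rule sw_coaction_times_coinvariant(2)[OF c]) (intro multilinear)
      then show "sw (\<Delta>P y) (\<lambda>p0 p1. \<beta> (x * c * p0) p1) = sw (\<Delta>P (c * y)) (\<lambda>p0 p1. \<beta> (x * p0) p1)"
        by (simp add: mult.assoc)
    qed
    then have "annihilates (\<lambda>(x, y). sw (\<Delta>P y) (\<lambda>y0 y1. \<beta> (x * y0) y1)) ?V"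
      by (simp add: annihilates_balanced)
    then show "sw (can_map sH sP \<Delta>P (?q X)) \<beta> = sw (can_map sH sP \<Delta>P (?q Y)) \<beta>"
      unfolding can_map_sw(2)[OF in' \<beta>]
      using eq[OF \<beta>] by (simp add: ev_qclass[OF subspace_balanced_sub])
  qed
  then have "?q X = ?q Y"
    using can_bij in' by (simp add: bij_betw_def inj_on_def)
  then have "X - Y \<in> ?V" by (simp add: qclass_eq_iff[OF subspace_balanced_sub])
  then have "lincomb (*) f (X - Y) = 0" using f' unfolding annihilates_def by blast
  then show ?thesis by (simp only: lincomb_field_simps right_minus_eq)
qed

text \<open>\<open>T\<close> is an inverse obtained by choice, so linearity has to be proved: the
  two sides have the same image under the canonical map, and \<open>can_injective\<close>
  applies.\<close>

lemma linear_translation [multilinear]: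
  assumes f: "balanced f" and g: "Vector_Spaces.linear s' sH g"
  shows "Vector_Spaces.linear s' (*) (\<lambda>x. sw (T (g x)) f)"
proof (rule linear_functional_comp[OF _ g])
  let ?r = "\<lambda>h. SOME x. x \<in> T h"
  let ?c = "\<lambda>\<beta>. \<lambda>(x, y). sw (\<Delta>P y) (\<lambda>y0 y1. \<beta> (x * y0) y1)"
  have r: "lincomb (*) (?c \<beta>) (?r h) = \<beta> 1 h" if "bilin sP sH \<beta>" for \<beta> h
    using sw_translation[OF that] by (simp add: ev_def)
  show "Vector_Spaces.linear sH (*) (\<lambda>h. sw (T h) f)"
    unfolding Vector_Spaces.linear_iff
  proof (intro conjI allI H.vector_space_axioms vector_space_field)
    fix h h' c
    have f': "balanced (\<lambda>x y. case_prod f (x, y))" using f by simp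
    have "lincomb (*) (case_prod f) (?r (h + h')) = lincomb (*) (case_prod f) (?r h + ?r h')"
    proof (rule can_injective[OF _ f'])
      fix \<beta> assume \<beta>: "bilin sP sH \<beta>"
      then have "\<beta> 1 (h + h') = \<beta> 1 h + \<beta> 1 h'"
        unfolding bilin_def by (metis linear_addD)
      then show "lincomb (*) (?c \<beta>) (?r (h + h')) = lincomb (*) (?c \<beta>) (?r h + ?r h')"
        by (simp only: lincomb_field_simps r[OF \<beta>])
    qed
    then show "sw (T (h + h')) f = sw (T h) f + sw (T h') f"
      by (simp add: ev_def)
    have "lincomb (*) (case_prod f) (?r (sH c h)) = lincomb (*) (case_prod f) (free_scale c (?r h))"
    proof (rule can_injective[OF _ f'])
      fix \<beta> assume \<beta>: "bilin sP sH \<beta>"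
      then have "\<beta> 1 (sH c h) = c * \<beta> 1 h"
        unfolding bilin_def by (metis linear_scaleD)
      then show "lincomb (*) (?c \<beta>) (?r (sH c h)) = lincomb (*) (?c \<beta>) (free_scale c (?r h))"
        by (simp only: lincomb_field_simps r[OF \<beta>])
    qed
    then show "sw (T (sH c h)) f = c * sw (T h) f"
      by (simp add: ev_def)
  qed
qed

text \<open>This is \<open>p \<otimes> p' = p p'\<^sub>0 p'\<^sub>1\<^sup>[\<^sup>1\<^sup>] \<otimes> p'\<^sub>1\<^sup>[\<^sup>2\<^sup>]\<close> in \<open>P \<otimes>\<^sub>B P\<close>.  It turns every
  further identity for the translation map into an application of \<open>sw_translation\<close>.\<close>

lemma translation_expand:
  assumes f: "balanced f"
  shows "sw (\<Delta>P y) (\<lambda>y0 y1. sw (T y1) (\<lambda>a b. f (x * y0 * a) b)) = f x y"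
proof -
  \<comment> \<open>The right-hand side of the expansion as an explicit formal sum, built from the
    representatives that \<open>ev\<close> chooses.\<close>
  define Y where "Y = lincomb free_scale (\<lambda>(y0, y1). lincomb free_scale (\<lambda>(a, b). gen (x * y0 * a, b))
    (SOME z. z \<in> T y1)) (SOME z. z \<in> \<Delta>P y)"
  have Y: "lincomb (*) g Y = sw (\<Delta>P y) (\<lambda>y0 y1. sw (T y1) (\<lambda>a b. g (x * y0 * a, b)))"
    for g :: "'p \<times> 'p \<Rightarrow> 'k"
    by (simp add: Y_def ev_def linear_lincomb_comp[OF linear_lincomb_field] case_prod_unfold)
  have "lincomb (*) (case_prod f) Y = lincomb (*) (case_prod f) (gen (x, y))"
  proof (rule can_injective)
    show "balanced (\<lambda>x y. case_prod f (x, y))" using f by simp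
    fix \<beta> assume \<beta>: "bilin sP sH \<beta>"
    note [multilinear] = bilin_left[OF \<beta>] bilin_right[OF \<beta>]
    have "sw (T y1) (\<lambda>a b. sw (\<Delta>P b) (\<lambda>b0 b1. \<beta> (x * y0 * (a * b0)) b1)) = \<beta> (x * y0 * 1) y1" for y0 y1
      by (rule sw_translation) (intro multilinear)
    then show "lincomb (*) (\<lambda>(x, y). sw (\<Delta>P y) (\<lambda>y0 y1. \<beta> (x * y0) y1)) Y =
      lincomb (*) (\<lambda>(x, y). sw (\<Delta>P y) (\<lambda>y0 y1. \<beta> (x * y0) y1)) (gen (x, y))"
      by (simp add: Y mult.assoc)
  qed
  then show ?thesis by (simp add: Y)
qed

lemma bilin_translation:
  assumes f: "balanced f"
  shows "bilin sP sH (\<lambda>p h. sw (T h) (\<lambda>a b. f (p * a) b))"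
proof -
  note [multilinear] = bilin_left[OF balanced_bilin[OF f]] bilin_right[OF balanced_bilin[OF f]]
  show ?thesis by (intro multilinear balanced_times_left f)
qed

lemma sw_translation_one:
  assumes f: "balanced f"
  shows "sw (T 1) f = f 1 1"
proof -
  have "sw (\<Delta>P 1) (\<lambda>y0 y1. sw (T y1) (\<lambda>a b. f (y0 * a) b)) = sw (T 1) (\<lambda>a b. f (1 * a) b)"
    by (rule sw_coaction_one[OF bilin_translation[OF f]])
  then show ?thesis using translation_expand[OF f, of 1 1] by simp
qed

text \<open>After \<open>translation_expand\<close>, \<open>b\<close> and \<open>d\<close> enter
  only through their coactions, with \<open>a * b0\<close> adjacent in the first argument. Applying
  \<open>sw_translation\<close> for \<open>h\<close> and then for \<open>k\<close> leaves the value
  at \<open>h * k\<close>.\<close>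

lemma sw_translation_mult:
  assumes f: "balanced f"
  shows "sw (T (h * k)) f = sw (T h) (\<lambda>a b. sw (T k) (\<lambda>c d. f (c * a) (b * d)))"
proof -
  \<comment> \<open>\<open>K\<close> is the form \<open>f\<close> transported to P tensor H along
    the inverse of the canonical map.\<close>
  define K where "K p g = sw (T g) (\<lambda>a b. f (p * a) b)" for p g
  have K: "bilin sP sH K" unfolding K_def by (rule bilin_translation[OF f])
  note [multilinear] = bilin_left[OF K] bilin_right[OF K]
  have e: "f (c * a) (b * d) = sw (\<Delta>P b) (\<lambda>b0 b1. sw (\<Delta>P d) (\<lambda>d0 d1. K (c * (a * b0) * d0) (b1 * d1)))"
    for a b c d
  proof -
    have "f (c * a) (b * d) = sw (\<Delta>P (b * d)) (\<lambda>q0 q1. K (c * a * q0) q1)"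
      unfolding K_def by (rule translation_expand[OF f, symmetric])
    also have "\<dots> = sw (\<Delta>P b) (\<lambda>b0 b1. sw (\<Delta>P d) (\<lambda>d0 d1. K (c * a * (b0 * d0)) (b1 * d1)))"
      by (rule sw_coaction_mult) (intro multilinear)
    finally show ?thesis by (simp add: mult.assoc)
  qed
  have "sw (T h) (\<lambda>a b. sw (T k) (\<lambda>c d. f (c * a) (b * d))) =
      sw (T k) (\<lambda>c d. sw (T h) (\<lambda>a b. f (c * a) (b * d)))"
    by (rule sw_commute)
  also have "\<dots> = sw (T k) (\<lambda>c d. sw (\<Delta>P d) (\<lambda>d0 d1. K (c * d0) (h * d1)))"
  proof -
    have "sw (T h) (\<lambda>a b. sw (\<Delta>P b) (\<lambda>b0 b1. sw (\<Delta>P d) (\<lambda>d0 d1. K (c * (a * b0) * d0) (b1 * d1)))) =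
        sw (\<Delta>P d) (\<lambda>d0 d1. K (c * 1 * d0) (h * d1))" for c d
      by (rule sw_translation[of "\<lambda>p g. sw (\<Delta>P d) (\<lambda>d0 d1. K (c * p * d0) (g * d1))"]) (intro multilinear)
    then show ?thesis by (simp add: e)
  qed
  also have "\<dots> = K 1 (h * k)"
    by (rule sw_translation[of "\<lambda>p g. K p (h * g)"]) (intro multilinear)
  finally show ?thesis by (simp add: K_def)
qed

section \<open>The coaction on the two legs of the translation map\<close>

context
  fixes f :: "'p \<Rightarrow> 'p \<Rightarrow> 'h \<Rightarrow> 'k"
  assumes f_balanced: "\<And>g. balanced (\<lambda>x y. f x y g)"
    and f_linear: "\<And>x y. Vector_Spaces.linear sH (*) (\<lambda>g. f x y g)"
begin

private lemma f_multilinear: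
  "Vector_Spaces.linear s sP g \<Longrightarrow> Vector_Spaces.linear s (*) (\<lambda>x. f (g x) q h)"
  "Vector_Spaces.linear s sP g \<Longrightarrow> Vector_Spaces.linear s (*) (\<lambda>x. f p (g x) h)"
  "Vector_Spaces.linear s sH g' \<Longrightarrow> Vector_Spaces.linear s (*) (\<lambda>x. f p q (g' x))"
  using bilin_left[OF balanced_bilin[OF f_balanced]] bilin_right[OF balanced_bilin[OF f_balanced]]
    linear_functional_comp[OF f_linear] by blast+

text \<open>\<open>h\<^sup>[\<^sup>1\<^sup>] \<otimes> h\<^sup>[\<^sup>2\<^sup>]\<^sub>0 \<otimes> h\<^sup>[\<^sup>2\<^sup>]\<^sub>1 = h\<^sub>1\<^sup>[\<^sup>1\<^sup>] \<otimes> h\<^sub>1\<^sup>[\<^sup>2\<^sup>] \<otimes> h\<^sub>2\<close>\<close>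

lemma translation_coaction_right:
  "sw (T h) (\<lambda>x y. sw (\<Delta>P y) (\<lambda>y0 y1. f x y0 y1)) =
    sw (\<Delta>H h) (\<lambda>h1 h2. sw (T h1) (\<lambda>a b. f a b h2))"
proof -
  note [multilinear] = f_multilinear balanced_times_left[OF f_balanced]
  \<comment> \<open>\<open>?G 1 h\<close> is the right-hand side; the factor \<open>p\<close> makes
    room for \<open>x * y0\<close>, as \<open>sw_translation\<close> requires.\<close>
  let ?G = "\<lambda>p h. sw (\<Delta>H h) (\<lambda>h1 h2. sw (T h1) (\<lambda>a b. f (p * a) b h2))"
  have "sw (\<Delta>P y) (\<lambda>y0 y1. f x y0 y1) = sw (\<Delta>P y) (\<lambda>y0 y1. ?G (x * y0) y1)" for x y
  proof -
    have "sw (\<Delta>P y) (\<lambda>y0 y1. f x y0 y1) =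
        sw (\<Delta>P y) (\<lambda>y' h2. sw (\<Delta>P y') (\<lambda>y0 h1. sw (T h1) (\<lambda>a b. f (x * y0 * a) b h2)))"
      by (simp only: translation_expand[OF f_balanced])
    also have "\<dots> = sw (\<Delta>P y) (\<lambda>y0 y1. ?G (x * y0) y1)"
      by (rule sw_coaction_coassoc; intro multilinear)
    finally show ?thesis .
  qed
  then have "sw (T h) (\<lambda>x y. sw (\<Delta>P y) (\<lambda>y0 y1. f x y0 y1)) =
      sw (T h) (\<lambda>x y. sw (\<Delta>P y) (\<lambda>y0 y1. ?G (x * y0) y1))"
    by simp
  also have "\<dots> = ?G 1 h"
    by (rule sw_translation) (intro multilinear)
  finally show ?thesis by simp
qed

text \<open>\<open>h\<^sup>[\<^sup>1\<^sup>]\<^sub>0 \<otimes> h\<^sup>[\<^sup>2\<^sup>] \<otimes> h\<^sup>[\<^sup>1\<^sup>]\<^sub>1 = h\<^sub>2\<^sup>[\<^sup>1\<^sup>] \<otimes> h\<^sub>2\<^sup>[\<^sup>2\<^sup>] \<otimes> S h\<^sub>1\<close>; the proof expands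
  \<open>x\<^sub>1\<close> as \<open>(x\<^sub>1 y\<^sub>1) S y\<^sub>2\<close>, where \<open>x\<^sub>1 y\<^sub>1\<close> comes from the coaction of \<open>x y\<^sub>0\<close>.\<close>

lemma translation_coaction_left:
  "sw (T h) (\<lambda>x y. sw (\<Delta>P x) (\<lambda>x0 x1. f x0 y x1)) =
    sw (\<Delta>H h) (\<lambda>h1 h2. sw (T h2) (\<lambda>a b. f a b (S h1)))"
proof -
  note [multilinear] = f_multilinear balanced_times_left[OF f_balanced]
  \<comment> \<open>At \<open>p = 1\<close> and \<open>q = 1\<close> this is the right-hand side.
    The extra factors receive the two components of the coaction of \<open>x * y0\<close>.\<close>
  let ?K = "\<lambda>p q z. sw (\<Delta>H z) (\<lambda>g1 g2. sw (T g2) (\<lambda>a b. f (p * a) b (q * S g1)))"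
  let ?G = "\<lambda>p h. sw (\<Delta>P p) (\<lambda>p0 p1. ?K p0 p1 h)"
  have "sw (\<Delta>P y) (\<lambda>y0 y1. ?G (x * y0) y1) = sw (\<Delta>P x) (\<lambda>x0 x1. f x0 y x1)" for x y
  proof -
    have "?G (x * y0) y1 = sw (\<Delta>P x) (\<lambda>x0 x1. sw (\<Delta>P y0) (\<lambda>y00 y01. ?K (x0 * y00) (x1 * y01) y1))" for y0 y1
      by (rule sw_coaction_mult) (intro multilinear)
    then have "sw (\<Delta>P y) (\<lambda>y0 y1. ?G (x * y0) y1) =
        sw (\<Delta>P y) (\<lambda>y0 y1. sw (\<Delta>P x) (\<lambda>x0 x1. sw (\<Delta>P y0) (\<lambda>y00 y01. ?K (x0 * y00) (x1 * y01) y1)))"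
      by simp
    also have "\<dots> = sw (\<Delta>P x) (\<lambda>x0 x1. sw (\<Delta>P y) (\<lambda>y0 y1. sw (\<Delta>P y0) (\<lambda>y00 y01. ?K (x0 * y00) (x1 * y01) y1)))"
      by (rule sw_commute)
    also have "\<dots> = sw (\<Delta>P x) (\<lambda>x0 x1. f x0 y x1)"
    proof -
      have "sw (\<Delta>P y) (\<lambda>y0 y1. sw (\<Delta>P y0) (\<lambda>y00 y01. ?K (x0 * y00) (x1 * y01) y1)) = f x0 y x1" for x0 x1
      proof -
        have "sw (\<Delta>P y) (\<lambda>y0 y1. sw (\<Delta>P y0) (\<lambda>y00 y01. ?K (x0 * y00) (x1 * y01) y1)) =
            sw (\<Delta>P y) (\<lambda>y0 z. sw (\<Delta>H z) (\<lambda>z1 z2. ?K (x0 * y0) (x1 * z1) z2))"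
          by (rule sw_coaction_coassoc; intro multilinear)
        also have "\<dots> = sw (\<Delta>P y) (\<lambda>y0 z. sw (T z) (\<lambda>a b. f (x0 * y0 * a) b x1))"
        proof -
          have "sw (\<Delta>H z) (\<lambda>z1 z2. ?K p (x1 * z1) z2) = sw (T z) (\<lambda>a b. f (p * a) b x1)" for p z
          proof -
            \<comment> \<open>Coassociativity makes \<open>z1\<close> and \<open>g1\<close> the legs
              of one coproduct, so that \<open>z1 * S g1\<close> reduces to the counit and
              \<open>x1\<close> is left alone.\<close>
            have "sw (\<Delta>H z) (\<lambda>z1 z2. ?K p (x1 * z1) z2) =
                sw (\<Delta>H z) (\<lambda>t g2. sw (\<Delta>H t) (\<lambda>z1 g1. sw (T g2) (\<lambda>a b. f (p * a) b (x1 * z1 * S g1))))"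
              by (rule H.sw_comult_coassoc[symmetric]; intro multilinear)
            also have "\<dots> = sw (\<Delta>H z) (\<lambda>t g2. \<epsilon> t * sw (T g2) (\<lambda>a b. f (p * a) b x1))"
            proof -
              have "sw (\<Delta>H t) (\<lambda>z1 g1. sw (T g2) (\<lambda>a b. f (p * a) b (x1 * (z1 * S g1)))) =
                  \<epsilon> t * sw (T g2) (\<lambda>a b. f (p * a) b (x1 * 1))" for t g2
                by (rule H.sw_antipode_right) (intro multilinear)
              then show ?thesis by (simp add: mult.assoc)
            qed
            also have "\<dots> = sw (T z) (\<lambda>a b. f (p * a) b x1)"
              by (rule H.sw_counit_left) (intro multilinear)
            finally show ?thesis .
          qed
          then show ?thesis by simp
        qed
        also have "\<dots> = f x0 y x1"
          by (rule translation_expand[OF f_balanced])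
        finally show ?thesis .
      qed
      then show ?thesis by simp
    qed
    finally show ?thesis .
  qed
  then have "sw (T h) (\<lambda>x y. sw (\<Delta>P x) (\<lambda>x0 x1. f x0 y x1)) =
      sw (T h) (\<lambda>x y. sw (\<Delta>P y) (\<lambda>y0 y1. ?G (x * y0) y1))"
    by simp
  also have "\<dots> = ?G 1 h"
    by (rule sw_translation) (intro multilinear)
  also have "\<dots> = ?K 1 1 h"
    by (rule sw_coaction_one) (intro multilinear)
  finally show ?thesis by simp
qed

end

end

section \<open>The action on a central extension\<close>

locale central_hopf_galois_extension = hopf_galois_extension +
  assumes bij_S: "bij S"
    and central: "b \<in> coinvariants sH sP \<Delta>P \<Longrightarrow> b * p = p * b"
begin

sublocale H: hopf_algebra_bij sH \<Delta>H \<epsilon> S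
  by unfold_locales (rule bij_S)

abbreviation "R \<equiv> inv S"

abbreviation "act \<equiv> galois_action sH S sP \<Delta>P"

text \<open>Centrality carries \<open>b\<close> from the right end of the product
  \<open>y * p * x * b\<close> to the left end. Hence the sum defining the action makes sense over
  \<open>B\<close>.\<close>

lemma balanced_sandwich:
  assumes \<phi>: "Vector_Spaces.linear sP (*) \<phi>"
  shows "balanced (\<lambda>x y. \<phi> (y * p * x))"
proof (rule balancedI)
  show "bilin sP sP (\<lambda>x y. \<phi> (y * p * x))"
    by (intro multilinear linear_functional_comp[OF \<phi>])
  show "\<phi> (y * p * (x * b)) = \<phi> (b * y * p * x)" if "b \<in> B" for x y b
    using central[OF that, of "y * p * x"] by (simp add: mult.assoc)
qed

lemma act_functional:
  assumes \<phi>: "Vector_Spaces.linear sP (*) \<phi>"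
  shows "\<phi> (act p h) = sw (T (R h)) (\<lambda>x y. \<phi> (y * p * x))"
  unfolding galois_action_def
  by (rule tsum_functional[OF subspace_balanced_sub
        translation_map_in[unfolded tensor_over_coinvariants_def] P.vector_space_axioms _ \<phi>])
    (simp add: annihilates_balanced balanced_sandwich)

section \<open>The module axioms for the action\<close>

lemma linear_act_left [multilinear]:
  assumes "Vector_Spaces.linear s' sP g"
  shows "Vector_Spaces.linear s' sP (\<lambda>x. act (g x) h)"
proof -
  have lin: "Vector_Spaces.linear sP (*) (\<lambda>p. \<phi> (act p h))" if \<phi>: "Vector_Spaces.linear sP (*) \<phi>" for \<phi>
    unfolding act_functional[OF \<phi>] by (intro multilinear linear_functional_comp[OF \<phi>])
  have "act (p + q) h = act p h + act q h" for p q
    by (rule P.eqI_functionals) (simp add: linear_addD[OF lin] linear_addD)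
  moreover have "act (sP c p) h = sP c (act p h)" for c p
    by (rule P.eqI_functionals) (simp add: linear_scaleD[OF lin] linear_scaleD)
  ultimately show ?thesis using assms by (simp add: Vector_Spaces.linear_iff)
qed

lemma linear_act_right [multilinear]:
  assumes "Vector_Spaces.linear s' sH g"
  shows "Vector_Spaces.linear s' sP (\<lambda>x. act p (g x))"
proof -
  have lin: "Vector_Spaces.linear sH (*) (\<lambda>h. \<phi> (act p h))" if \<phi>: "Vector_Spaces.linear sP (*) \<phi>" for \<phi>
    unfolding act_functional[OF \<phi>] by (intro multilinear balanced_sandwich \<phi>)
  have "act p (h + k) = act p h + act p k" for h k
    by (rule P.eqI_functionals) (simp add: linear_addD[OF lin] linear_addD)
  moreover have "act p (sH c h) = sP c (act p h)" for c h
    by (rule P.eqI_functionals) (simp add: linear_scaleD[OF lin] linear_scaleD)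
  ultimately show ?thesis
    using assms P.vector_space_axioms by (simp add: Vector_Spaces.linear_iff)
qed

lemma act_one: "act p 1 = p"
proof (rule P.eqI_functionals)
  fix \<phi> assume \<phi>: "Vector_Spaces.linear sP (*) \<phi>"
  show "\<phi> (act p 1) = \<phi> p"
    using sw_translation_one[OF balanced_sandwich[OF \<phi>]]
    by (simp add: act_functional[OF \<phi>] H.inv_antipode_one)
qed

text \<open>\<open>R\<close> reverses the product \<open>h * g\<close>, and
  \<open>sw_translation_mult\<close> then nests the sandwich for \<open>R h\<close> inside the one
  for \<open>R g\<close>.\<close>

lemma act_mult: "act p (h * g) = act (act p h) g"
proof (rule P.eqI_functionals)
  fix \<phi> assume \<phi>: "Vector_Spaces.linear sP (*) \<phi>"
  have "\<phi> (act p (h * g)) = sw (T (R g)) (\<lambda>x y. sw (T (R h)) (\<lambda>x' y'. \<phi> (y * y' * p * (x' * x))))"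
    by (simp add: act_functional[OF \<phi>] H.inv_antipode_mult sw_translation_mult[OF balanced_sandwich[OF \<phi>]])
  also have "\<dots> = sw (T (R g)) (\<lambda>x y. \<phi> (y * act p h * x))"
  proof -
    have "Vector_Spaces.linear sP (*) (\<lambda>q. \<phi> (y * q * x))" for x y
      by (intro multilinear linear_functional_comp[OF \<phi>])
    from act_functional[OF this] show ?thesis by (simp add: mult.assoc)
  qed
  finally show "\<phi> (act p (h * g)) = \<phi> (act (act p h) g)"
    by (simp add: act_functional[OF \<phi>])
qed

lemma right_module_act: "right_module sH sP act"
  by (intro right_module.intro right_module_axioms.intro H.k_algebra_axioms P.vector_space_axioms
      multilinear act_one act_mult)

text \<open>The coaction of \<open>y * m * x\<close> is multiplicative. For the legs of T(k) with k
  = \<open>R h\<close>, the factor \<open>y\<close> contributes the last coproduct leg of k and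
  \<open>x\<close> the antipode of the first; the middle leg remains as the action.\<close>

lemma sw_coaction_act:
  assumes \<beta>: "bilin sP sH \<beta>"
  shows "sw (\<Delta>P (act m h)) \<beta> = sw (\<Delta>P m) (\<lambda>m0 m1. sw (\<Delta>H h) (\<lambda>h1 h'. sw (\<Delta>H h') (\<lambda>h2 h3.
    \<beta> (act m0 h2) (R h1 * m1 * h3))))"
proof -
  note [multilinear] = bilin_left[OF \<beta>] bilin_right[OF \<beta>]
  let ?f = "\<lambda>x y g. sw (\<Delta>P m) (\<lambda>m0 m1. sw (\<Delta>P x) (\<lambda>x0 x1. \<beta> (y * m0 * x0) (g * m1 * x1)))"
  have "sw (\<Delta>P (act m h)) \<beta> = sw (T (R h)) (\<lambda>x y. sw (\<Delta>P (y * m * x)) \<beta>)"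
    by (rule act_functional) (intro multilinear)
  also have "\<dots> = sw (T (R h)) (\<lambda>x y. sw (\<Delta>P y) (\<lambda>y0 y1. ?f x y0 y1))"
  proof -
    have "sw (\<Delta>P (y * m * x)) \<beta> = sw (\<Delta>P y) (\<lambda>y0 y1. ?f x y0 y1)" for x y
    proof -
      have "sw (\<Delta>P (y * m * x)) \<beta> = sw (\<Delta>P (y * m)) (\<lambda>q0 q1. sw (\<Delta>P x) (\<lambda>x0 x1. \<beta> (q0 * x0) (q1 * x1)))"
        by (rule sw_coaction_mult[OF \<beta>])
      also have "\<dots> = sw (\<Delta>P y) (\<lambda>y0 y1. ?f x y0 y1)"
        by (rule sw_coaction_mult) (intro multilinear)
      finally show ?thesis .
    qed
    then show ?thesis by simp
  qed
  also have "\<dots> = sw (\<Delta>H (R h)) (\<lambda>k k3. sw (T k) (\<lambda>x y. ?f x y k3))"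
  proof (rule translation_coaction_right)
    show "Vector_Spaces.linear sH (*) (\<lambda>g. ?f x y g)" for x y
      by (intro multilinear)
    \<comment> \<open>As in \<open>balanced_sandwich\<close>, \<open>b\<close> passes around the
      product by centrality; since it is coinvariant, the component in H is unaffected.\<close>
    show "balanced (\<lambda>x y. ?f x y g)" for g
    proof (rule balancedI)
      show "bilin sP sP (\<lambda>x y. ?f x y g)" by (intro multilinear)
      fix x b y assume b: "b \<in> B"
      have "sw (\<Delta>P (x * b)) (\<lambda>x0 x1. \<beta> (y * m0 * x0) (g * m1 * x1)) =
          sw (\<Delta>P x) (\<lambda>x0 x1. \<beta> (y * m0 * (x0 * b)) (g * m1 * x1))" for m0 m1
        by (rule sw_coaction_times_coinvariant(1)[OF b]) (intro multilinear)
      moreover have "y * m0 * (x0 * b) = b * y * m0 * x0" for m0 x0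
        using central[OF b, of "y * m0 * x0"] by (simp add: mult.assoc)
      ultimately show "?f (x * b) y g = ?f x (b * y) g" by simp
    qed
  qed
  also have "\<dots> = sw (\<Delta>P m) (\<lambda>m0 m1. sw (\<Delta>H (R h)) (\<lambda>k k3. sw (\<Delta>H k) (\<lambda>k1 k2.
      \<beta> (act m0 (S k2)) (k3 * m1 * S k1))))"
  proof -
    have "sw (T k) (\<lambda>x y. ?f x y k3) =
        sw (\<Delta>P m) (\<lambda>m0 m1. sw (\<Delta>H k) (\<lambda>k1 k2. \<beta> (act m0 (S k2)) (k3 * m1 * S k1)))" for k k3
    proof -
      have "sw (T k) (\<lambda>x y. sw (\<Delta>P x) (\<lambda>x0 x1. \<beta> (y * m0 * x0) (k3 * m1 * x1))) =
          sw (\<Delta>H k) (\<lambda>k1 k2. sw (T k2) (\<lambda>x y. \<beta> (y * m0 * x) (k3 * m1 * S k1)))" for m0 m1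
        by (rule translation_coaction_left[of "\<lambda>x y g. \<beta> (y * m0 * x) (k3 * m1 * g)"])
          (intro multilinear balanced_sandwich[of "\<lambda>z. \<beta> z _"])+
      \<comment> \<open>The action evaluates the translation map at \<open>R\<close> of its
        argument, so a sandwich by \<open>T k2\<close> is the action of \<open>S k2\<close>.\<close>
      moreover have "sw (T k2) (\<lambda>x y. \<beta> (y * m0 * x) q) = \<beta> (act m0 (S k2)) q" for k2 m0 q
      proof -
        have "Vector_Spaces.linear sP (*) (\<lambda>z. \<beta> z q)" by (intro multilinear)
        from act_functional[OF this] show ?thesis by simp
      qed
      ultimately show ?thesis by (subst sw_commute) simp
    qed
    then show ?thesis by (simp only:) (rule sw_commute)
  qed
  also have "\<dots> = sw (\<Delta>P m) (\<lambda>m0 m1. sw (\<Delta>H h) (\<lambda>h1 h'. sw (\<Delta>H h') (\<lambda>h2 h3.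
    \<beta> (act m0 h2) (R h1 * m1 * h3))))"
  proof -
    \<comment> \<open>\<open>R\<close> reverses coproducts: the legs \<open>k1\<close>,
      \<open>k2\<close>, \<open>k3\<close> of \<open>R h\<close> are \<open>R h3\<close>,
      \<open>R h2\<close>, \<open>R h1\<close>, and the outer antipodes cancel the first
      two.\<close>
    have "sw (\<Delta>H (R h)) (\<lambda>k k3. sw (\<Delta>H k) (\<lambda>k1 k2. \<beta> (act m0 (S k2)) (k3 * m1 * S k1))) =
        sw (\<Delta>H h) (\<lambda>h1 h'. sw (\<Delta>H (R h')) (\<lambda>k1 k2. \<beta> (act m0 (S k2)) (R h1 * m1 * S k1)))" for m0 m1
      by (rule H.sw_comult_inv_antipode) (intro multilinear)
    moreover have "sw (\<Delta>H (R h')) (\<lambda>k1 k2. \<beta> (act m0 (S k2)) (q * S k1)) =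
        sw (\<Delta>H h') (\<lambda>h2 h3. \<beta> (act m0 (S (R h2))) (q * S (R h3)))" for h' m0 q
      by (rule H.sw_comult_inv_antipode) (intro multilinear)
    ultimately show ?thesis by simp
  qed
  finally show ?thesis .
qed

text \<open>Bilinearity at each level makes the nested sums well defined, and evaluating them at all
  forms reduces the equation to \<open>sw_coaction_act\<close>.\<close>

lemma anti_yetter_drinfeld_act:
  "\<Delta>P (act m h) =
    tqsum (tensor_sub sP sH) (\<Delta>P m) (\<lambda>m0 m1.
      tqsum (tensor_sub sP sH) (\<Delta>H h) (\<lambda>h1 h'.
        tqsum (tensor_sub sP sH) (\<Delta>H h') (\<lambda>h2 h3.
          pure sP sH (act m0 h2) (R h1 * m1 * h3))))"
proof -
  let ?U = "tensor_sub sP sH"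
  note vs = P.vector_space_axioms H.vector_space_axioms
  have b: "bilin sP sH (\<lambda>a b. \<psi> (a, b))" if "annihilates \<psi> ?U" for \<psi> :: "_ \<Rightarrow> 'a"
    using that by (simp add: annihilates_tensor_sub[OF vs])
  note p = ev_pure and q = pure_in_qspace
  let ?t3 = "\<lambda>m0 m1 h1 h'. tqsum ?U (\<Delta>H h') (\<lambda>h2 h3. pure sP sH (act m0 h2) (R h1 * m1 * h3))"
  let ?t2 = "\<lambda>m0 m1. tqsum ?U (\<Delta>H h) (\<lambda>h1 h'. ?t3 m0 m1 h1 h')"
  have b3: "\<forall>\<psi>. annihilates \<psi> ?U \<longrightarrow>
      bilin sH sH (\<lambda>h2 h3. ev \<psi> (pure sP sH (act m0 h2) (R h1 * m1 * h3)))" for m0 m1 h1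
  proof (intro allI impI)
    fix \<psi> :: "_ \<Rightarrow> 'a" assume \<psi>: "annihilates \<psi> ?U"
    show "bilin sH sH (\<lambda>h2 h3. ev \<psi> (pure sP sH (act m0 h2) (R h1 * m1 * h3)))"
      unfolding p[OF \<psi>] by (intro multilinear bilin_left[OF b[OF \<psi>]] bilin_right[OF b[OF \<psi>]])
  qed
  note t3 = tqsum_tensor[OF vs(2,2) subspace_tensor_sub H.comult_in_qspace q b3]
  have b2: "\<forall>\<psi>. annihilates \<psi> ?U \<longrightarrow> bilin sH sH (\<lambda>h1 h'. ev \<psi> (?t3 m0 m1 h1 h'))" for m0 m1
  proof (intro allI impI)
    fix \<psi> :: "_ \<Rightarrow> 'a" assume \<psi>: "annihilates \<psi> ?U"
    show "bilin sH sH (\<lambda>h1 h'. ev \<psi> (?t3 m0 m1 h1 h'))"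
      unfolding t3(2)[OF \<psi>] p[OF \<psi>]
      by (intro multilinear bilin_left[OF b[OF \<psi>]] bilin_right[OF b[OF \<psi>]])
  qed
  note t2 = tqsum_tensor[OF vs(2,2) subspace_tensor_sub H.comult_in_qspace t3(1) b2]
  have b1: "\<forall>\<psi>. annihilates \<psi> ?U \<longrightarrow> bilin sP sH (\<lambda>m0 m1. ev \<psi> (?t2 m0 m1))"
  proof (intro allI impI)
    fix \<psi> :: "_ \<Rightarrow> 'a" assume \<psi>: "annihilates \<psi> ?U"
    show "bilin sP sH (\<lambda>m0 m1. ev \<psi> (?t2 m0 m1))"
      unfolding t2(2)[OF \<psi>] t3(2)[OF \<psi>] p[OF \<psi>]
      by (intro multilinear bilin_left[OF b[OF \<psi>]] bilin_right[OF b[OF \<psi>]])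
  qed
  note t1 = tqsum_tensor[OF vs subspace_tensor_sub coaction_in_qspace t2(1) b1]
  show ?thesis
  proof (rule tensor_eqI[OF vs coaction_in_qspace t1(1)])
    fix \<beta> assume \<beta>: "bilin sP sH \<beta>"
    then have \<psi>: "annihilates (case_prod \<beta>) ?U" by (simp add: annihilates_tensor_sub[OF vs])
    show "sw (\<Delta>P (act m h)) \<beta> = sw (tqsum ?U (\<Delta>P m) ?t2) \<beta>"
      unfolding t1(2)[OF \<psi>] t2(2)[OF \<psi>] t3(2)[OF \<psi>] p[OF \<psi>]
      by (simp add: sw_coaction_act[OF \<beta>])
  qed
qed

lemma stable_act: "tsum sP (\<Delta>P p) (\<lambda>p0 p1. act p0 p1) = p"
proof (rule P.eqI_functionals)
  fix \<phi> assume \<phi>: "Vector_Spaces.linear sP (*) \<phi>"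
  note [multilinear] = linear_functional_comp[OF \<phi>]
  have f: "balanced (\<lambda>x y. \<phi> (y * x))"
    using balanced_sandwich[OF \<phi>, of 1] by simp
  \<comment> \<open>The balanced form \<open>\<phi> (y * x)\<close> transported along the inverse of
    the canonical map; at \<open>g = 1\<close> it gives \<open>\<phi> q\<close>.\<close>
  define K where "K q g = sw (T g) (\<lambda>a b. \<phi> (b * (q * a)))" for q g
  have K: "bilin sP sH K" unfolding K_def by (rule bilin_translation[OF f])
  note [multilinear] = bilin_left[OF K] bilin_right[OF K]
  have "\<phi> (tsum sP (\<Delta>P p) act) = sw (\<Delta>P p) (\<lambda>p0 p1. \<phi> (act p0 p1))"
  proof (rule tsum_tensor[OF P.vector_space_axioms H.vector_space_axioms P.vector_space_axioms
        coaction_in_qspace _ \<phi>])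
    fix \<psi> assume \<psi>: "Vector_Spaces.linear sP (*) \<psi>"
    show "bilin sP sH (\<lambda>p0 p1. \<psi> (act p0 p1))"
      by (intro multilinear linear_functional_comp[OF \<psi>])
  qed
  also have "\<dots> = sw (\<Delta>P p) (\<lambda>p0 p1. sw (\<Delta>P p0) (\<lambda>p00 p01. K p00 (R p1 * p01)))"
  proof -
    have "\<phi> (act p0 g) = sw (\<Delta>P p0) (\<lambda>p00 p01. K p00 (R g * p01))" for p0 g
    proof -
      have "\<phi> (y * p0 * x) = sw (\<Delta>P y) (\<lambda>y0 y1. sw (\<Delta>P p0) (\<lambda>p00 p01. K (x * y0 * p00) (y1 * p01)))" for x y
      proof -
        \<comment> \<open>\<open>y * p0\<close> is treated as the second leg and expanded, so that
          summing over \<open>T (R g)\<close> leaves only the coaction of \<open>p0\<close>.\<close>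
        have "\<phi> (y * p0 * x) = sw (\<Delta>P (y * p0)) (\<lambda>q0 q1. K (x * q0) q1)"
          unfolding K_def by (rule translation_expand[OF f, symmetric])
        also have "\<dots> = sw (\<Delta>P y) (\<lambda>y0 y1. sw (\<Delta>P p0) (\<lambda>p00 p01. K (x * (y0 * p00)) (y1 * p01)))"
          by (rule sw_coaction_mult) (intro multilinear)
        finally show ?thesis by (simp add: mult.assoc)
      qed
      then have "\<phi> (act p0 g) = sw (T (R g)) (\<lambda>x y. sw (\<Delta>P y) (\<lambda>y0 y1.
          sw (\<Delta>P p0) (\<lambda>p00 p01. K (x * y0 * p00) (y1 * p01))))"
        by (simp add: act_functional[OF \<phi>])
      also have "\<dots> = sw (\<Delta>P p0) (\<lambda>p00 p01. K (1 * p00) (R g * p01))"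
        by (rule sw_translation[of "\<lambda>q g. sw (\<Delta>P p0) (\<lambda>p00 p01. K (q * p00) (g * p01))"])
          (intro multilinear)
      finally show ?thesis by simp
    qed
    then show ?thesis by simp
  qed
  \<comment> \<open>The two coactions become one coaction followed by a coproduct, and
    \<open>R z2 * z1\<close> is then the counit by \<open>sw_inv_antipode\<close>.\<close>
  also have "\<dots> = sw (\<Delta>P p) (\<lambda>p0 z. sw (\<Delta>H z) (\<lambda>z1 z2. K p0 (R z2 * z1)))"
    by (rule sw_coaction_coassoc; intro multilinear)
  also have "\<dots> = sw (\<Delta>P p) (\<lambda>p0 z. \<epsilon> z * K p0 1)"
  proof -
    have "sw (\<Delta>H z) (\<lambda>z1 z2. K p0 (R z2 * z1)) = \<epsilon> z * K p0 1" for p0 z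
      by (rule H.sw_inv_antipode) (intro multilinear)
    then show ?thesis by simp
  qed
  also have "\<dots> = K p 1"
    by (rule sw_coaction_counit) (intro multilinear)
  also have "\<dots> = \<phi> p"
    unfolding K_def using sw_translation_one[OF balanced_times_left[OF f, of p]] by simp
  finally show "\<phi> (tsum sP (\<Delta>P p) (\<lambda>p0 p1. act p0 p1)) = \<phi> p" .
qed

end

theorem proposition3p1:
  fixes sH :: "'k::field \<Rightarrow> 'h::{ring,monoid_mult} \<Rightarrow> 'h"
    and \<Delta>H :: "'h \<Rightarrow> ('h \<times> 'h \<Rightarrow>\<^sub>0 'k) set"
    and \<epsilon> :: "'h \<Rightarrow> 'k"
    and S :: "'h \<Rightarrow> 'h"
    and sP :: "'k \<Rightarrow> 'p::{ring,monoid_mult} \<Rightarrow> 'p"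
    and \<Delta>P :: "'p \<Rightarrow> ('p \<times> 'h \<Rightarrow>\<^sub>0 'k) set"
  assumes "hopf_algebra sH \<Delta>H \<epsilon> S"
    and "bij S"
    and "hopf_galois_extension sH \<Delta>H \<epsilon> S sP \<Delta>P"
    and "\<forall>b\<in>coinvariants sH sP \<Delta>P. \<forall>p. b * p = p * b"
  shows "stable_anti_yetter_drinfeld_module sH \<Delta>H \<epsilon> S sP (galois_action sH S sP \<Delta>P) \<Delta>P"
proof -
  interpret central_hopf_galois_extension sH \<Delta>H \<epsilon> S sP \<Delta>P
    using assms(2-4)
    by (intro central_hopf_galois_extension.intro central_hopf_galois_extension_axioms.intro) blast+
  show ?thesis
    by (intro stable_anti_yetter_drinfeld_module.intro anti_yetter_drinfeld_module.intro
        anti_yetter_drinfeld_module_axioms.intro stable_anti_yetter_drinfeld_module_axioms.intro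
        assms(1,2) right_module_act right_comodule_axioms anti_yetter_drinfeld_act stable_act)
qed

end
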